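(* Let $(\epsilon_1,\epsilon_2)\in\{(-1,-1),(-1,1),(1,-1)\}$ and $\epsilon=-\epsilon_1\epsilon_2$. Let $L$ be the simply connected Lie group with Lie algebra $\mathfrak{l}$, $\bar g$ the left-invariant metric on $L$ defined by the scalar product $\langle\cdot,\cdot\rangle$ on $\mathfrak{l}$, $Q=\mathrm{span}\{J_1,J_2,J_3\}$, and $\tilde J_1$, all as given in the context. Then $(L,\bar g,Q)$ is an $\epsilon$-quaternionic-Kähler manifold with left-invariant $\epsilon$-quaternionic structure $Q$, and $J_1$, $\tilde J_1$ are integrable left-invariant skew-symmetric $\epsilon_1$-complex structures on $(L,\bar g)$.
   Context: The Lie algebra $\mathfrak{l}$ (the Iwasawa subalgebra of the split real form of type $G_2$) has basis $(T_1,\dots,T_8)=(V_2,U^2,A,B,V_0,V_1,U^0,U^1)$ with brackets (all not determined by these and skew-symmetry vanish): $[B,A]=\frac1{\sqrt3}A$, $[U^2,V_2]=V_2$, $[V_0,U^0]=-V_2$, $[V_1,U^1]=-V_2$, $[U^2,V_I]=\frac12V_I$ and $[U^2,U^I]=\frac12U^I$ for $I=0,1$, $[B,V_0]=-\frac{\sqrt3}2V_0$, $[B,V_1]=-\frac1{2\sqrt3}V_1$, $[B,U^0]=\frac{\sqrt3}2U^0$, $[B,U^1]=\frac1{2\sqrt3}U^1$, $[A,V_0]=V_1$, $[A,U^1]=-U^0$, $[A,V_1]=-\frac2{\sqrt3}U^1$. The scalar product $\langle\cdot,\cdot\rangle$ has Gram matrix $\mathrm{diag}(-\epsilon_1,1,-\epsilon_1,1,-\epsilon,-\epsilon_2,-\epsilon_2,-\epsilon)$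 in this basis. Bivectors are identified with skew-symmetric endomorphisms by $(u\wedge v)(w)=u\langle v,w\rangle-\langle u,w\rangle v$. Define $$J_1=\epsilon_2U^2\wedge V_2-B\wedge A+\epsilon\tfrac{\sqrt3}2U^1\wedge U^0-\epsilon_2\tfrac12U^1\wedge V_1+\epsilon_2\tfrac12U^0\wedge V_0+\epsilon\tfrac{\sqrt3}2V_1\wedge V_0,$$ $$J_2=\epsilon_2\tfrac{\sqrt3}2U^1\wedge V_2+\epsilon\tfrac12V_0\wedge V_2-\tfrac12U^0\wedge U^2-\epsilon_1\tfrac{\sqrt3}2V_1\wedge U^2-\tfrac12U^1\wedge A-\epsilon_1\tfrac{\sqrt3}2V_0\wedge A-\tfrac{\sqrt3}2U^0\wedge B+\epsilon_1\tfrac12V_1\wedge B,$$ $$J_3=\epsilon_2\tfrac12U^0\wedge V_2-\epsilon\tfrac{\sqrt3}2V_1\wedge V_2-\epsilon_1\tfrac{\sqrt3}2U^1\wedge U^2+\tfrac12V_0\wedge U^2-\tfrac{\sqrt3}2U^0\wedge A+\epsilon_1\tfrac12V_1\wedge A-\epsilon_1\tfrac12U^1\wedge B-\tfrac{\sqrt3}2V_0\wedge B,$$ $$\tilde J_1=-\epsilon_2U^2\wedge V_2-B\wedge A+\epsilon\tfrac{\sqrt3}2U^1\wedge U^0-\epsilon_2\tfrac12U^1\wedge V_1+\epsilon_2\tfrac12U^0\wedge V_0+\epsilon\tfrac{\sqrt3}2V_1\wedge V_0.$$ These endomorphisms of $\mathfrak{l}$ are identified with left-invariant endomorphism fields on $L$;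 $Q$ is the corresponding left-invariant rank-3 subbundle of $\mathrm{End}(TL)$. Terminology. "$\epsilon$-complex", "$\epsilon$-quaternionic" etc. means "complex", "quaternionic" etc. if $\epsilon=-1$ and "para-complex", "para-quaternionic" etc. if $\epsilon=1$. An almost $\epsilon_1$-complex structure is an endomorphism field $J$ with $J^2=\epsilon_1\mathrm{Id}$ (with, if $\epsilon_1=1$, $\pm1$-eigendistributions of equal rank); it is integrable if its Nijenhuis tensor $N_J(X,Y)=-J^2[X,Y]+J[JX,Y]+J[X,JY]-[JX,JY]$ vanishes. A pseudo-Riemannian manifold $(M,g)$ of dimension $4n>4$ with a subbundle $Q\subset\mathrm{End}(TM)$ is $\epsilon$-quaternionic-Kähler if $Q$ is parallel for the Levi-Civita connection and is pointwise spanned by three pairwise anti-commuting $g$-skew-symmetric endomorphisms $I,J,K=IJ$ with $I^2=J^2=K^2=-\mathrm{Id}$ if $\epsilon=-1$, respectively with two of them squaring to $\mathrm{Id}$ and the third to $-\mathrm{Id}$ if $\epsilon=1$. *)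

theory Defs
  imports "HOL-Analysis.Analysis"
begin

section \<open>Smooth maps between normed spaces\<close>

text \<open>Intended for open domains and finite-dimensional sources, where iterated directional
  derivatives characterise the classes \<open>C\<^sup>k\<close>.\<close>

primrec ck_on :: "nat \<Rightarrow> 'a::real_normed_vector set \<Rightarrow> ('a \<Rightarrow> 'b::real_normed_vector) \<Rightarrow> bool" where
  "ck_on 0 S f \<longleftrightarrow> continuous_on S f"
| "ck_on (Suc k) S f \<longleftrightarrow> (\<forall>x\<in>S. f differentiable (at x)) \<and>
     (\<forall>v. ck_on k S (\<lambda>x. frechet_derivative f (at x) v))"

definition smooth_on :: "'a::real_normed_vector set \<Rightarrow> ('a \<Rightarrow> 'b::real_normed_vector) \<Rightarrow> bool" where
  "smooth_on S f \<longleftrightarrow> (\<forall>k. ck_on k S f)"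


section \<open>Smooth manifolds\<close>

text \<open>A manifold is a topological type with an atlas; a chart is a pair of its domain and its
  coordinate map.\<close>

type_synonym ('a, 'b) chart = "'a set \<times> ('a \<Rightarrow> 'b)"
type_synonym ('a, 'b) atlas = "('a, 'b) chart set"

definition param :: "('a, 'b) chart \<Rightarrow> 'b \<Rightarrow> 'a" where
  "param c = inv_into (fst c) (snd c)"

definition is_chart :: "('a::topological_space, 'b::euclidean_space) chart \<Rightarrow> bool" where
  "is_chart c \<longleftrightarrow> open (fst c) \<and> open (snd c ` fst c) \<and> inj_on (snd c) (fst c) \<and>
     continuous_on (fst c) (snd c) \<and> continuous_on (snd c ` fst c) (param c)"

definition smooth_manifold ::
  "('a::{t2_space,second_countable_topology}, 'b::euclidean_space) atlas \<Rightarrow> bool" where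
  "smooth_manifold M \<longleftrightarrow> (\<forall>c\<in>M. is_chart c) \<and> (\<Union>c\<in>M. fst c) = UNIV \<and>
     (\<forall>c\<in>M. \<forall>d\<in>M. smooth_on (snd c ` (fst c \<inter> fst d)) (snd d \<circ> param c))"

definition prod_atlas :: "('a, 'b) atlas \<Rightarrow> ('c, 'd) atlas \<Rightarrow> ('a \<times> 'c, 'b \<times> 'd) atlas" where
  "prod_atlas M N = {(fst c \<times> fst d, map_prod (snd c) (snd d)) | c d. c \<in> M \<and> d \<in> N}"

definition smooth_map :: "('a::topological_space, 'b::euclidean_space) atlas \<Rightarrow>
    ('c::topological_space, 'd::euclidean_space) atlas \<Rightarrow> ('a \<Rightarrow> 'c) \<Rightarrow> bool" where
  "smooth_map M N F \<longleftrightarrow> continuous_on UNIV F \<and>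
     (\<forall>c\<in>M. \<forall>d\<in>N. smooth_on (snd c ` (fst c \<inter> F -` fst d)) (snd d \<circ> F \<circ> param c))"

definition smooth_fun :: "('a, 'b::euclidean_space) atlas \<Rightarrow> ('a \<Rightarrow> real) \<Rightarrow> bool" where
  "smooth_fun M f \<longleftrightarrow> (\<forall>c\<in>M. smooth_on (snd c ` fst c) (f \<circ> param c))"

text \<open>Every point carries one chosen chart of the atlas, and a tangent vector at \<open>p\<close> is
  represented by its components in the chart chosen at \<open>p\<close>.  So every tangent space is modelled on
  the type \<open>'b\<close>, but a tensor field is smooth when its components are smooth in each chart
  of the atlas, not when it is smooth as a function of the point into the model.\<close>

definition chart_at :: "('a, 'b) atlas \<Rightarrow> 'a \<Rightarrow> ('a, 'b) chart" where
  "chart_at M p = (SOME c. c \<in> M \<and> p \<in> fst c)"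

text \<open>Components in the chart \<open>c\<close> of a tangent vector at \<open>p\<close>, and back.\<close>

definition to_chart :: "('a, 'b::euclidean_space) atlas \<Rightarrow> ('a, 'b) chart \<Rightarrow> 'a \<Rightarrow> 'b \<Rightarrow> 'b" where
  "to_chart M c p =
     frechet_derivative (snd c \<circ> param (chart_at M p)) (at (snd (chart_at M p) p))"

definition from_chart :: "('a, 'b::euclidean_space) atlas \<Rightarrow> ('a, 'b) chart \<Rightarrow> 'a \<Rightarrow> 'b \<Rightarrow> 'b" where
  "from_chart M c p = frechet_derivative (snd (chart_at M p) \<circ> param c) (at (snd c p))"

definition differential ::
  "('a, 'b::euclidean_space) atlas \<Rightarrow> ('a \<Rightarrow> 'a) \<Rightarrow> 'a \<Rightarrow> 'b \<Rightarrow> 'b" where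
  "differential M F p =
     frechet_derivative (snd (chart_at M (F p)) \<circ> F \<circ> param (chart_at M p))
       (at (snd (chart_at M p) p))"


section \<open>Vector fields\<close>

definition field_in_chart ::
  "('a, 'b::euclidean_space) atlas \<Rightarrow> ('a, 'b) chart \<Rightarrow> ('a \<Rightarrow> 'b) \<Rightarrow> 'b \<Rightarrow> 'b" where
  "field_in_chart M c X x = to_chart M c (param c x) (X (param c x))"

definition smooth_vf :: "('a, 'b::euclidean_space) atlas \<Rightarrow> ('a \<Rightarrow> 'b) \<Rightarrow> bool" where
  "smooth_vf M X \<longleftrightarrow> (\<forall>c\<in>M. smooth_on (snd c ` fst c) (field_in_chart M c X))"

definition vf_apply ::
  "('a, 'b::euclidean_space) atlas \<Rightarrow> ('a \<Rightarrow> 'b) \<Rightarrow> ('a \<Rightarrow> real) \<Rightarrow> 'a \<Rightarrow> real" where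
  "vf_apply M X f p =
     frechet_derivative (f \<circ> param (chart_at M p)) (at (snd (chart_at M p) p)) (X p)"

text \<open>\<open>[X, Y] = X\<^sup>i \<partial>\<^sub>i Y - Y\<^sup>i \<partial>\<^sub>i X\<close> in the chart chosen at the point, that is,
  \<open>[X, Y] f = X (Y f) - Y (X f)\<close>.\<close>

definition lie_bracket ::
  "('a, 'b::euclidean_space) atlas \<Rightarrow> ('a \<Rightarrow> 'b) \<Rightarrow> ('a \<Rightarrow> 'b) \<Rightarrow> 'a \<Rightarrow> 'b" where
  "lie_bracket M X Y p = (let c = chart_at M p in
     frechet_derivative (field_in_chart M c Y) (at (snd c p)) (X p) -
     frechet_derivative (field_in_chart M c X) (at (snd c p)) (Y p))"


section \<open>Endomorphism fields, metrics and connections\<close>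

definition smooth_endo_on ::
  "('a, 'b::euclidean_space) atlas \<Rightarrow> 'a set \<Rightarrow> ('a \<Rightarrow> 'b \<Rightarrow>\<^sub>L 'b) \<Rightarrow> bool" where
  "smooth_endo_on M W S \<longleftrightarrow> (\<forall>c\<in>M. \<forall>v. smooth_on (snd c ` (fst c \<inter> W))
     (\<lambda>x. let p = param c x in to_chart M c p (blinfun_apply (S p) (from_chart M c p v))))"

definition endo_apply :: "('a \<Rightarrow> 'b::real_normed_vector \<Rightarrow>\<^sub>L 'b) \<Rightarrow> ('a \<Rightarrow> 'b) \<Rightarrow> 'a \<Rightarrow> 'b" where
  "endo_apply S X p = blinfun_apply (S p) (X p)"

definition endo_subbundle ::
  "('a::topological_space, 'b::euclidean_space) atlas \<Rightarrow> nat \<Rightarrow> ('a \<Rightarrow> ('b \<Rightarrow>\<^sub>L 'b) set) \<Rightarrow> bool" where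
  "endo_subbundle M r Q \<longleftrightarrow> (\<forall>p. \<exists>W F. open W \<and> p \<in> W \<and> (\<forall>k<r. smooth_endo_on M W (F k)) \<and>
     (\<forall>q\<in>W. Q q = span {F k q | k. k < r} \<and> dim (Q q) = r))"

definition endo_section ::
  "('a, 'b::euclidean_space) atlas \<Rightarrow> ('a \<Rightarrow> ('b \<Rightarrow>\<^sub>L 'b) set) \<Rightarrow> ('a \<Rightarrow> 'b \<Rightarrow>\<^sub>L 'b) \<Rightarrow> bool" where
  "endo_section M Q S \<longleftrightarrow> smooth_endo_on M UNIV S \<and> (\<forall>p. S p \<in> Q p)"

definition pseudo_riemannian ::
  "('a, 'b::euclidean_space) atlas \<Rightarrow> ('a \<Rightarrow> 'b \<Rightarrow> 'b \<Rightarrow> real) \<Rightarrow> bool" where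
  "pseudo_riemannian M g \<longleftrightarrow>
     (\<forall>p. bilinear (g p) \<and> (\<forall>u v. g p u v = g p v u) \<and> (\<forall>u. (\<forall>v. g p u v = 0) \<longrightarrow> u = 0)) \<and>
     (\<forall>c\<in>M. \<forall>u v. smooth_on (snd c ` fst c)
        (\<lambda>x. let p = param c x in g p (from_chart M c p u) (from_chart M c p v)))"

definition skew_endo :: "('b::real_normed_vector \<Rightarrow> 'b \<Rightarrow> real) \<Rightarrow> ('b \<Rightarrow>\<^sub>L 'b) \<Rightarrow> bool" where
  "skew_endo h S \<longleftrightarrow> (\<forall>u v. h (blinfun_apply S u) v = - h u (blinfun_apply S v))"

definition affine_connection :: "('a, 'b::euclidean_space) atlas \<Rightarrow>
    (('a \<Rightarrow> 'b) \<Rightarrow> ('a \<Rightarrow> 'b) \<Rightarrow> 'a \<Rightarrow> 'b) \<Rightarrow> bool" where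
  "affine_connection M D \<longleftrightarrow>
     (\<forall>X Y. smooth_vf M X \<longrightarrow> smooth_vf M Y \<longrightarrow> smooth_vf M (D X Y)) \<and>
     (\<forall>X Y Z. smooth_vf M X \<longrightarrow> smooth_vf M Y \<longrightarrow> smooth_vf M Z \<longrightarrow>
        (\<forall>p. D (\<lambda>q. X q + Y q) Z p = D X Z p + D Y Z p \<and>
             D X (\<lambda>q. Y q + Z q) p = D X Y p + D X Z p)) \<and>
     (\<forall>f X Y. smooth_fun M f \<longrightarrow> smooth_vf M X \<longrightarrow> smooth_vf M Y \<longrightarrow>
        (\<forall>p. D (\<lambda>q. f q *\<^sub>R X q) Y p = f p *\<^sub>R D X Y p \<and>
             D X (\<lambda>q. f q *\<^sub>R Y q) p = vf_apply M X f p *\<^sub>R Y p + f p *\<^sub>R D X Y p))"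

definition levi_civita :: "('a, 'b::euclidean_space) atlas \<Rightarrow> ('a \<Rightarrow> 'b \<Rightarrow> 'b \<Rightarrow> real) \<Rightarrow>
    (('a \<Rightarrow> 'b) \<Rightarrow> ('a \<Rightarrow> 'b) \<Rightarrow> 'a \<Rightarrow> 'b) \<Rightarrow> bool" where
  "levi_civita M g D \<longleftrightarrow> affine_connection M D \<and>
     (\<forall>X Y. smooth_vf M X \<longrightarrow> smooth_vf M Y \<longrightarrow>
        (\<forall>p. D X Y p - D Y X p = lie_bracket M X Y p)) \<and>
     (\<forall>X Y Z. smooth_vf M X \<longrightarrow> smooth_vf M Y \<longrightarrow> smooth_vf M Z \<longrightarrow>
        (\<forall>p. vf_apply M X (\<lambda>q. g q (Y q) (Z q)) p = g p (D X Y p) (Z p) + g p (Y p) (D X Z p)))"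

text \<open>The section \<open>R\<close> below is the covariant derivative of \<open>S\<close> along \<open>X\<close>, which is determined by
  \<open>(D\<^sub>X S) Y = D\<^sub>X (S Y) - S (D\<^sub>X Y)\<close>.\<close>

definition parallel_subbundle :: "('a, 'b::euclidean_space) atlas \<Rightarrow>
    (('a \<Rightarrow> 'b) \<Rightarrow> ('a \<Rightarrow> 'b) \<Rightarrow> 'a \<Rightarrow> 'b) \<Rightarrow> ('a \<Rightarrow> ('b \<Rightarrow>\<^sub>L 'b) set) \<Rightarrow> bool" where
  "parallel_subbundle M D Q \<longleftrightarrow> (\<forall>X S. smooth_vf M X \<longrightarrow> endo_section M Q S \<longrightarrow>
     (\<exists>R. endo_section M Q R \<and> (\<forall>Y. smooth_vf M Y \<longrightarrow>
        (\<forall>p. endo_apply R Y p = D X (endo_apply S Y) p - endo_apply S (D X Y) p))))"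


section \<open>\<open>\<epsilon>\<close>-complex and \<open>\<epsilon>\<close>-quaternionic structures\<close>

definition almost_eps_complex ::
  "('a, 'b::euclidean_space) atlas \<Rightarrow> real \<Rightarrow> ('a \<Rightarrow> 'b \<Rightarrow>\<^sub>L 'b) \<Rightarrow> bool" where
  "almost_eps_complex M eps J \<longleftrightarrow> smooth_endo_on M UNIV J \<and>
     (\<forall>p. J p o\<^sub>L J p = eps *\<^sub>R id_blinfun) \<and>
     (eps = 1 \<longrightarrow> (\<forall>p. dim {v. blinfun_apply (J p) v = v} = dim {v. blinfun_apply (J p) v = - v}))"

definition nijenhuis :: "('a, 'b::euclidean_space) atlas \<Rightarrow> ('a \<Rightarrow> 'b \<Rightarrow>\<^sub>L 'b) \<Rightarrow>
    ('a \<Rightarrow> 'b) \<Rightarrow> ('a \<Rightarrow> 'b) \<Rightarrow> 'a \<Rightarrow> 'b" where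
  "nijenhuis M J X Y p =
     - endo_apply J (endo_apply J (lie_bracket M X Y)) p
     + endo_apply J (lie_bracket M (endo_apply J X) Y) p
     + endo_apply J (lie_bracket M X (endo_apply J Y)) p
     - lie_bracket M (endo_apply J X) (endo_apply J Y) p"

definition integrable_endo ::
  "('a, 'b::euclidean_space) atlas \<Rightarrow> ('a \<Rightarrow> 'b \<Rightarrow>\<^sub>L 'b) \<Rightarrow> bool" where
  "integrable_endo M J \<longleftrightarrow>
     (\<forall>X Y. smooth_vf M X \<longrightarrow> smooth_vf M Y \<longrightarrow> (\<forall>p. nijenhuis M J X Y p = 0))"

definition eps_quaternionic_algebra ::
  "real \<Rightarrow> ('b::real_normed_vector \<Rightarrow> 'b \<Rightarrow> real) \<Rightarrow> ('b \<Rightarrow>\<^sub>L 'b) set \<Rightarrow> bool" where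
  "eps_quaternionic_algebra eps h q \<longleftrightarrow> (\<exists>I J K.
     q = span {I, J, K} \<and> K = I o\<^sub>L J \<and>
     I o\<^sub>L J = - (J o\<^sub>L I) \<and> J o\<^sub>L K = - (K o\<^sub>L J) \<and> K o\<^sub>L I = - (I o\<^sub>L K) \<and>
     skew_endo h I \<and> skew_endo h J \<and> skew_endo h K \<and>
     (eps = -1 \<and> I o\<^sub>L I = - id_blinfun \<and> J o\<^sub>L J = - id_blinfun \<and> K o\<^sub>L K = - id_blinfun \<or>
      eps = 1 \<and>
        (I o\<^sub>L I = id_blinfun \<and> J o\<^sub>L J = id_blinfun \<and> K o\<^sub>L K = - id_blinfun \<or>
         I o\<^sub>L I = id_blinfun \<and> J o\<^sub>L J = - id_blinfun \<and> K o\<^sub>L K = id_blinfun \<or>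
         I o\<^sub>L I = - id_blinfun \<and> J o\<^sub>L J = id_blinfun \<and> K o\<^sub>L K = id_blinfun)))"

text \<open>The Levi-Civita connection is unique as an operator on smooth vector fields only, so it is
  addressed by asserting that one exists and quantifying over all of them.\<close>

definition eps_quaternionic_kaehler ::
  "('a::{t2_space,second_countable_topology}, 'b::euclidean_space) atlas \<Rightarrow> real \<Rightarrow>
    ('a \<Rightarrow> 'b \<Rightarrow> 'b \<Rightarrow> real) \<Rightarrow> ('a \<Rightarrow> ('b \<Rightarrow>\<^sub>L 'b) set) \<Rightarrow> bool" where
  "eps_quaternionic_kaehler M eps g Q \<longleftrightarrow>
     smooth_manifold M \<and> (\<exists>n>1. DIM('b) = 4 * n) \<and> pseudo_riemannian M g \<and>
     endo_subbundle M 3 Q \<and> (\<forall>p. eps_quaternionic_algebra eps (g p) (Q p)) \<and>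
     (\<exists>D. levi_civita M g D) \<and> (\<forall>D. levi_civita M g D \<longrightarrow> parallel_subbundle M D Q)"


section \<open>Lie groups and left-invariant tensor fields\<close>

definition lie_group :: "('a::{t2_space,second_countable_topology}, 'b::euclidean_space) atlas \<Rightarrow>
    ('a \<Rightarrow> 'a \<Rightarrow> 'a) \<Rightarrow> 'a \<Rightarrow> ('a \<Rightarrow> 'a) \<Rightarrow> bool" where
  "lie_group M mul e inver \<longleftrightarrow> smooth_manifold M \<and> group mul e inver \<and>
     smooth_map (prod_atlas M M) M (\<lambda>(p, q). mul p q) \<and> smooth_map M M inver"

definition left_invariant_vf ::
  "('a, 'b::euclidean_space) atlas \<Rightarrow> ('a \<Rightarrow> 'a \<Rightarrow> 'a) \<Rightarrow> ('a \<Rightarrow> 'b) \<Rightarrow> bool" where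
  "left_invariant_vf M mul X \<longleftrightarrow> (\<forall>a p. X (mul a p) = differential M (mul a) p (X p))"

definition left_invariant_endo ::
  "('a, 'b::euclidean_space) atlas \<Rightarrow> ('a \<Rightarrow> 'a \<Rightarrow> 'a) \<Rightarrow> ('a \<Rightarrow> 'b \<Rightarrow>\<^sub>L 'b) \<Rightarrow> bool" where
  "left_invariant_endo M mul S \<longleftrightarrow> (\<forall>a p v.
     blinfun_apply (S (mul a p)) (differential M (mul a) p v) =
     differential M (mul a) p (blinfun_apply (S p) v))"

definition left_invariant_subbundle ::
  "('a, 'b::euclidean_space) atlas \<Rightarrow> ('a \<Rightarrow> 'a \<Rightarrow> 'a) \<Rightarrow> ('a \<Rightarrow> ('b \<Rightarrow>\<^sub>L 'b) set) \<Rightarrow> bool" where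
  "left_invariant_subbundle M mul Q \<longleftrightarrow> (\<forall>a p. Q (mul a p) =
     {R. \<exists>S\<in>Q p. \<forall>v. blinfun_apply R (differential M (mul a) p v) =
                     differential M (mul a) p (blinfun_apply S v)})"

text \<open>\<open>\<iota>\<close> is an isomorphism from the Lie algebra with underlying vector space \<open>'l\<close> and bracket
  \<open>br\<close> onto the Lie algebra of left-invariant vector fields.\<close>

definition lie_algebra_iso :: "('a, 'b::euclidean_space) atlas \<Rightarrow> ('a \<Rightarrow> 'a \<Rightarrow> 'a) \<Rightarrow>
    ('l::real_vector \<Rightarrow> 'l \<Rightarrow> 'l) \<Rightarrow> ('l \<Rightarrow> 'a \<Rightarrow> 'b) \<Rightarrow> bool" where
  "lie_algebra_iso M mul br \<iota> \<longleftrightarrow>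
     bij_betw \<iota> UNIV {X. smooth_vf M X \<and> left_invariant_vf M mul X} \<and>
     (\<forall>p. linear (\<lambda>x. \<iota> x p)) \<and>
     (\<forall>x y. \<iota> (br x y) = lie_bracket M (\<iota> x) (\<iota> y))"

text \<open>The left trivialisation: \<open>\<iota>\<close> followed by evaluation at \<open>p\<close> is a linear bijection from the
  Lie algebra to the tangent space at \<open>p\<close>, and this is its inverse.\<close>

definition left_triv :: "('l \<Rightarrow> 'a \<Rightarrow> 'b) \<Rightarrow> 'a \<Rightarrow> 'b \<Rightarrow> 'l" where
  "left_triv \<iota> p = inv (\<lambda>x. \<iota> x p)"

definition invariant_form ::
  "('l \<Rightarrow> 'a \<Rightarrow> 'b) \<Rightarrow> ('l \<Rightarrow> 'l \<Rightarrow> real) \<Rightarrow> 'a \<Rightarrow> 'b \<Rightarrow> 'b \<Rightarrow> real" where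
  "invariant_form \<iota> h p u v = h (left_triv \<iota> p u) (left_triv \<iota> p v)"

definition invariant_endo ::
  "('l \<Rightarrow> 'a \<Rightarrow> 'b::real_normed_vector) \<Rightarrow> ('l \<Rightarrow> 'l) \<Rightarrow> 'a \<Rightarrow> 'b \<Rightarrow>\<^sub>L 'b" where
  "invariant_endo \<iota> A p = Blinfun (\<lambda>v. \<iota> (A (left_triv \<iota> p v)) p)"


section \<open>The Iwasawa algebra of the split form of \<open>G\<^sub>2\<close>\<close>

datatype iwa_index = BV2 | BU2 | BA | BB | BV0 | BV1 | BU0 | BU1

lemma UNIV_iwa_index: "UNIV = {BV2, BU2, BA, BB, BV0, BV1, BU0, BU1}"
  using iwa_index.exhaust by auto

instance iwa_index :: finite
  by standard (simp add: UNIV_iwa_index)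

type_synonym iwa = "real ^ iwa_index"

abbreviation eV2 :: iwa where "eV2 \<equiv> axis BV2 1"
abbreviation eU2 :: iwa where "eU2 \<equiv> axis BU2 1"
abbreviation eA :: iwa where "eA \<equiv> axis BA 1"
abbreviation eB :: iwa where "eB \<equiv> axis BB 1"
abbreviation eV0 :: iwa where "eV0 \<equiv> axis BV0 1"
abbreviation eV1 :: iwa where "eV1 \<equiv> axis BV1 1"
abbreviation eU0 :: iwa where "eU0 \<equiv> axis BU0 1"
abbreviation eU1 :: iwa where "eU1 \<equiv> axis BU1 1"

text \<open>\<open>(\<lambda>x y. alt2 i j x y *\<^sub>R z)\<close> is the alternating bilinear map that sends the \<open>i\<close>-th and
  \<open>j\<close>-th basis vector to \<open>z\<close> and vanishes on all other pairs of basis vectors (up to order).\<close>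

definition alt2 :: "iwa_index \<Rightarrow> iwa_index \<Rightarrow> iwa \<Rightarrow> iwa \<Rightarrow> real" where
  "alt2 i j x y = x $ i * y $ j - x $ j * y $ i"

definition iwa_bracket :: "iwa \<Rightarrow> iwa \<Rightarrow> iwa" where
  "iwa_bracket x y =
     alt2 BB BA x y *\<^sub>R ((1 / sqrt 3) *\<^sub>R eA)
   + alt2 BU2 BV2 x y *\<^sub>R eV2
   + alt2 BV0 BU0 x y *\<^sub>R (- eV2)
   + alt2 BV1 BU1 x y *\<^sub>R (- eV2)
   + alt2 BU2 BV0 x y *\<^sub>R ((1 / 2) *\<^sub>R eV0)
   + alt2 BU2 BV1 x y *\<^sub>R ((1 / 2) *\<^sub>R eV1)
   + alt2 BU2 BU0 x y *\<^sub>R ((1 / 2) *\<^sub>R eU0)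
   + alt2 BU2 BU1 x y *\<^sub>R ((1 / 2) *\<^sub>R eU1)
   + alt2 BB BV0 x y *\<^sub>R (- (sqrt 3 / 2) *\<^sub>R eV0)
   + alt2 BB BV1 x y *\<^sub>R (- (1 / (2 * sqrt 3)) *\<^sub>R eV1)
   + alt2 BB BU0 x y *\<^sub>R ((sqrt 3 / 2) *\<^sub>R eU0)
   + alt2 BB BU1 x y *\<^sub>R ((1 / (2 * sqrt 3)) *\<^sub>R eU1)
   + alt2 BA BV0 x y *\<^sub>R eV1
   + alt2 BA BU1 x y *\<^sub>R (- eU0)
   + alt2 BA BV1 x y *\<^sub>R (- (2 / sqrt 3) *\<^sub>R eU1)"

definition eps_of :: "real \<Rightarrow> real \<Rightarrow> real" where
  "eps_of e1 e2 = - e1 * e2"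

fun iwa_gram :: "real \<Rightarrow> real \<Rightarrow> iwa_index \<Rightarrow> real" where
  "iwa_gram e1 e2 BV2 = - e1"
| "iwa_gram e1 e2 BU2 = 1"
| "iwa_gram e1 e2 BA = - e1"
| "iwa_gram e1 e2 BB = 1"
| "iwa_gram e1 e2 BV0 = - eps_of e1 e2"
| "iwa_gram e1 e2 BV1 = - e2"
| "iwa_gram e1 e2 BU0 = - e2"
| "iwa_gram e1 e2 BU1 = - eps_of e1 e2"

definition iwa_form :: "real \<Rightarrow> real \<Rightarrow> iwa \<Rightarrow> iwa \<Rightarrow> real" where
  "iwa_form e1 e2 x y = (\<Sum>k\<in>UNIV. iwa_gram e1 e2 k * x $ k * y $ k)"

definition wedge :: "real \<Rightarrow> real \<Rightarrow> iwa \<Rightarrow> iwa \<Rightarrow> iwa \<Rightarrow> iwa" where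
  "wedge e1 e2 u v w = iwa_form e1 e2 v w *\<^sub>R u - iwa_form e1 e2 u w *\<^sub>R v"

definition J1 :: "real \<Rightarrow> real \<Rightarrow> iwa \<Rightarrow> iwa" where
  "J1 e1 e2 w = (let e = eps_of e1 e2; W = (\<lambda>u v. wedge e1 e2 u v w) in
     e2 *\<^sub>R W eU2 eV2 - W eB eA + (e * sqrt 3 / 2) *\<^sub>R W eU1 eU0 - (e2 / 2) *\<^sub>R W eU1 eV1
     + (e2 / 2) *\<^sub>R W eU0 eV0 + (e * sqrt 3 / 2) *\<^sub>R W eV1 eV0)"

definition J2 :: "real \<Rightarrow> real \<Rightarrow> iwa \<Rightarrow> iwa" where
  "J2 e1 e2 w = (let e = eps_of e1 e2; W = (\<lambda>u v. wedge e1 e2 u v w) in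
     (e2 * sqrt 3 / 2) *\<^sub>R W eU1 eV2 + (e / 2) *\<^sub>R W eV0 eV2 - (1 / 2) *\<^sub>R W eU0 eU2
     - (e1 * sqrt 3 / 2) *\<^sub>R W eV1 eU2 - (1 / 2) *\<^sub>R W eU1 eA - (e1 * sqrt 3 / 2) *\<^sub>R W eV0 eA
     - (sqrt 3 / 2) *\<^sub>R W eU0 eB + (e1 / 2) *\<^sub>R W eV1 eB)"

definition J3 :: "real \<Rightarrow> real \<Rightarrow> iwa \<Rightarrow> iwa" where
  "J3 e1 e2 w = (let e = eps_of e1 e2; W = (\<lambda>u v. wedge e1 e2 u v w) in
     (e2 / 2) *\<^sub>R W eU0 eV2 - (e * sqrt 3 / 2) *\<^sub>R W eV1 eV2 - (e1 * sqrt 3 / 2) *\<^sub>R W eU1 eU2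
     + (1 / 2) *\<^sub>R W eV0 eU2 - (sqrt 3 / 2) *\<^sub>R W eU0 eA + (e1 / 2) *\<^sub>R W eV1 eA
     - (e1 / 2) *\<^sub>R W eU1 eB - (sqrt 3 / 2) *\<^sub>R W eV0 eB)"

definition J1_tilde :: "real \<Rightarrow> real \<Rightarrow> iwa \<Rightarrow> iwa" where
  "J1_tilde e1 e2 w = (let e = eps_of e1 e2; W = (\<lambda>u v. wedge e1 e2 u v w) in
     - e2 *\<^sub>R W eU2 eV2 - W eB eA + (e * sqrt 3 / 2) *\<^sub>R W eU1 eU0 - (e2 / 2) *\<^sub>R W eU1 eV1
     + (e2 / 2) *\<^sub>R W eU0 eV0 + (e * sqrt 3 / 2) *\<^sub>R W eV1 eV0)"

end

theory Submission
  imports Defs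
begin

text \<open>Evaluation at a point identifies the Lie algebra with every tangent space: it is injective
  by left invariance, and surjective because a tangent vector at the unit extends to a smooth
  left-invariant field.  So the basis becomes a global frame, and all tensors are
  described by their frame components, which are smooth by Cramer's rule.  In the frame the bracket
  of \<open>X\<close> and \<open>Y\<close> is \<open>X y - Y x + [x, y]\<close> and the Levi-Civita connection is
  \<open>D\<^sub>X Y = X y + \<Gamma> x y\<close>, where \<open>\<Gamma>\<close> is given by the Koszul formula on the Lie
  algebra; the uniqueness part of the Koszul argument identifies it with every other Levi-Civita
  connection.  Parallelism of \<open>Q\<close> is then the purely algebraic statement
  that commutation with each \<open>\<Gamma> x\<close> preserves \<open>span {J\<^sub>1, J\<^sub>2, J\<^sub>3}\<close>, and the Nijenhuis tensor reduces
  to its value on the Lie algebra; both are checked in the given basis.\<close>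

section \<open>Calculus of smooth maps\<close>

text \<open>The chart that represents tangent vectors at a point is picked by a choice operator, so
  a smooth field, seen as a function into the model space, may jump from point to point. Frame
  components escape this: they do not depend on the selected chart and are honest smooth functions.
  Fields, endomorphisms and metrics thus become vectors, matrices and forms with smooth entries, and
  charts are needed only to get there.

  The signs stay symbolic, subject only to \<open>e1 * e1 = 1\<close> and
  \<open>e2 * e2 = 1\<close>, and \<epsilon> is eliminated as \<open>- e1 * e2\<close>, so one
  computation serves all cases. The quaternionic type is read off from the relation J1 J2 = J3 and
  the squares e1, e2, - e1 e2. The pair (1, 1) is excluded because the squares 1, 1, -1 belong to
  the para-quaternionic algebra, whereas \<epsilon> would be -1. \<open>J1_tilde\<close> is
  \<open>J1\<close> with its sign reversed on the plane of \<open>eV2\<close> and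
  \<open>eU2\<close>; it lies outside the span of the three structures.\<close>

lemma ck_on_subset: "ck_on k S f \<Longrightarrow> T \<subseteq> S \<Longrightarrow> ck_on k T f"
  by (induction k arbitrary: f) (auto intro: continuous_on_subset)

text \<open>Holds even without differentiability: \<open>frechet_derivative\<close> is a choice
  among all derivatives at the point, and both functions have the same ones.\<close>

lemma frechet_derivative_cong_open:
  assumes "open S" "x \<in> S" "\<And>y. y \<in> S \<Longrightarrow> f y = g y"
  shows "frechet_derivative f (at x) = frechet_derivative g (at x)"
proof -
  have "(f has_derivative D) (at x) \<longleftrightarrow> (g has_derivative D) (at x)" for D
    using assms by (metis has_derivative_transform_within_open)
  then show ?thesis
    by (simp add: frechet_derivative_def)
qed

text \<open>The derivatives in \<open>ck_on\<close> are full ones, not relative to \<open>S\<close>;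
  openness is what makes them depend on the values on \<open>S\<close> alone.\<close>

lemma ck_on_cong:
  assumes "ck_on k S f" "open S" "\<And>x. x \<in> S \<Longrightarrow> f x = g x"
  shows "ck_on k S g"
  using assms(1,3)
proof (induction k arbitrary: f g)
  case 0
  then show ?case
    using continuous_on_cong[of S S f g] by simp
next
  case (Suc k)
  have "g differentiable at x" if x: "x \<in> S" for x
  proof -
    obtain D where "(f has_derivative D) (at x)"
      using Suc.prems(1) x by (auto simp: differentiable_def)
    then have "(g has_derivative D) (at x)"
      using has_derivative_transform_within_open[of f D x UNIV S g] assms(2) x Suc.prems(2)
      by simp
    then show ?thesis
      by (auto simp: differentiable_def)
  qed
  moreover have "ck_on k S (\<lambda>x. frechet_derivative g (at x) v)" for v
  proof (rule Suc.IH)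
    show "ck_on k S (\<lambda>x. frechet_derivative f (at x) v)"
      using Suc.prems by simp
    show "frechet_derivative f (at x) v = frechet_derivative g (at x) v" if "x \<in> S" for x
      using frechet_derivative_cong_open[OF assms(2) that, of f g] Suc.prems by simp
  qed
  ultimately show ?case
    by simp
qed

lemma differentiable_imp_continuous_on_open:
  "(\<forall>x\<in>S. f differentiable (at x)) \<Longrightarrow> continuous_on S f"
  by (meson continuous_at_imp_continuous_on differentiable_imp_continuous_within)

text \<open>Product and chain rule multiply a derivative by an undifferentiated factor, which must
  first be moved to the lower class.\<close>

lemma ck_on_Suc_D: "ck_on (Suc k) S f \<Longrightarrow> ck_on k S f"
proof (induction k arbitrary: f)
  case 0
  then show ?case
    by (auto intro: differentiable_imp_continuous_on_open)
next
  case (Suc k)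
  then show ?case
    by (metis ck_on.simps(2))
qed

lemma ck_on_const: "ck_on k S (\<lambda>x. c)"
  by (induction k arbitrary: c) (auto simp: frechet_derivative_const)

lemma ck_on_add:
  assumes "ck_on k S f" "ck_on k S g" "open S"
  shows "ck_on k S (\<lambda>x. f x + g x)"
  using assms(1,2)
proof (induction k arbitrary: f g)
  case 0
  then show ?case by (auto intro: continuous_intros)
next
  case (Suc k)
  have "ck_on k S (\<lambda>x. frechet_derivative (\<lambda>x. f x + g x) (at x) v)" for v
  proof (rule ck_on_cong[OF _ assms(3)])
    show "ck_on k S (\<lambda>x. frechet_derivative f (at x) v + frechet_derivative g (at x) v)"
      by (rule Suc.IH) (use Suc.prems in auto)
    fix x assume "x \<in> S"
    then have "f differentiable (at x)" "g differentiable (at x)"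
      using Suc.prems by auto
    then show "frechet_derivative f (at x) v + frechet_derivative g (at x) v =
        frechet_derivative (\<lambda>x. f x + g x) (at x) v"
      using frechet_derivative_at[OF has_derivative_add[OF
            frechet_derivative_works[THEN iffD1] frechet_derivative_works[THEN iffD1]], of f x g] by metis
  qed
  then show ?case
    using Suc.prems by auto
qed

lemma ck_on_bounded_linear:
  assumes "ck_on k S f" "open S" "bounded_linear L"
  shows "ck_on k S (\<lambda>x. L (f x))"
  using assms(1)
proof (induction k arbitrary: f)
  case 0
  then show ?case
    by (simp add: bounded_linear.continuous_on[OF assms(3)])
next
  case (Suc k)
  have D: "((\<lambda>x. L (f x)) has_derivative (\<lambda>v. L (frechet_derivative f (at x) v))) (at x)"
    if "x \<in> S" for x
    using Suc.prems that
    by (intro bounded_linear.has_derivative[OF assms(3)]) (auto simp: frechet_derivative_works)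
  have "ck_on k S (\<lambda>x. frechet_derivative (\<lambda>x. L (f x)) (at x) v)" for v
  proof (rule ck_on_cong[OF _ assms(2)])
    show "ck_on k S (\<lambda>x. L (frechet_derivative f (at x) v))"
      by (rule Suc.IH) (use Suc.prems in auto)
    show "L (frechet_derivative f (at x) v) = frechet_derivative (\<lambda>x. L (f x)) (at x) v"
      if "x \<in> S" for x
      using frechet_derivative_at[OF D[OF that]] by metis
  qed
  then show ?case
    using D by (auto simp: differentiable_def)
qed

text \<open>The product rule yields two terms of the same bilinear shape with other arguments, hence
  an induction over both functions at once.\<close>

lemma ck_on_bounded_bilinear:
  assumes "ck_on k S f" "ck_on k S g" "open S" "bounded_bilinear B"
  shows "ck_on k S (\<lambda>x. B (f x) (g x))"
  using assms(1,2)
proof (induction k arbitrary: f g)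
  case 0
  then show ?case
    by (simp add: bounded_bilinear.continuous_on[OF assms(4)])
next
  case (Suc k)
  have D: "((\<lambda>x. B (f x) (g x)) has_derivative
      (\<lambda>v. B (f x) (frechet_derivative g (at x) v) + B (frechet_derivative f (at x) v) (g x))) (at x)"
    if "x \<in> S" for x
    using Suc.prems that
    by (intro bounded_bilinear.FDERIV[OF assms(4)]) (auto simp: frechet_derivative_works)
  have "ck_on k S (\<lambda>x. frechet_derivative (\<lambda>x. B (f x) (g x)) (at x) v)" for v
  proof (rule ck_on_cong[OF _ assms(3)])
    show "ck_on k S (\<lambda>x. B (f x) (frechet_derivative g (at x) v) +
        B (frechet_derivative f (at x) v) (g x))"
      using Suc.prems ck_on_Suc_D[OF Suc.prems(1)] ck_on_Suc_D[OF Suc.prems(2)]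
      by (intro ck_on_add assms(3) Suc.IH) auto
    show "B (f x) (frechet_derivative g (at x) v) + B (frechet_derivative f (at x) v) (g x) =
        frechet_derivative (\<lambda>x. B (f x) (g x)) (at x) v"
      if "x \<in> S" for x
      using frechet_derivative_at[OF D[OF that]] by metis
  qed
  then show ?case
    using D by (auto simp: differentiable_def)
qed

lemma ck_on_sum:
  assumes "\<And>i. i \<in> I \<Longrightarrow> ck_on k S (f i)" "open S"
  shows "ck_on k S (\<lambda>x. \<Sum>i\<in>I. f i x)"
  using assms(1)
  by (induction I rule: infinite_finite_induct) (auto intro: ck_on_const ck_on_add assms(2))

text \<open>\<open>ck_on\<close> differentiates in fixed directions only. The chain rule produces a
  direction that moves with the point; this expansion splits it into fixed directions with variable
  coefficients.\<close>

lemma frechet_derivative_euclidean_expand: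
  fixes f :: "'a::euclidean_space \<Rightarrow> 'b::real_normed_vector"
  assumes "f differentiable (at x)"
  shows "frechet_derivative f (at x) v = (\<Sum>b\<in>Basis. (v \<bullet> b) *\<^sub>R frechet_derivative f (at x) b)"
proof -
  have l: "linear (frechet_derivative f (at x))"
    using assms by (rule linear_frechet_derivative)
  have "frechet_derivative f (at x) v =
      frechet_derivative f (at x) (\<Sum>b\<in>Basis. (v \<bullet> b) *\<^sub>R b)"
    by (simp add: euclidean_representation)
  then show ?thesis
    by (simp only: linear_sum[OF l] linear_scale[OF l])
qed

text \<open>Only the outer function varies in the induction: after one differentiation the terms are
  partial derivatives of \<open>f\<close> composed with the same \<open>g\<close>.\<close>

lemma ck_on_compose:
  fixes g :: "'a::real_normed_vector \<Rightarrow> 'b::euclidean_space" and f :: "'b \<Rightarrow> 'c::real_normed_vector"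
  assumes "ck_on k T f" "ck_on k S g" "open S" "open T" "g ` S \<subseteq> T"
  shows "ck_on k S (\<lambda>x. f (g x))"
  using assms(1,2)
proof (induction k arbitrary: f)
  case 0
  then show ?case
    using assms(5) by (auto intro: continuous_on_compose2)
next
  case (Suc k)
  have df: "f differentiable (at (g x))" and dg: "g differentiable (at x)" if "x \<in> S" for x
    using Suc.prems that assms(5) by auto
  have D: "((\<lambda>x. f (g x)) has_derivative
      (\<lambda>v. frechet_derivative f (at (g x)) (frechet_derivative g (at x) v))) (at x)"
    if "x \<in> S" for x
    using diff_chain_at[OF dg[OF that, unfolded frechet_derivative_works]
        df[OF that, unfolded frechet_derivative_works]]
    by (simp add: o_def)
  have "ck_on k S (\<lambda>x. frechet_derivative (\<lambda>x. f (g x)) (at x) v)" for v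
  proof (rule ck_on_cong[OF _ assms(3)])
    show "ck_on k S (\<lambda>x. \<Sum>b\<in>Basis. (frechet_derivative g (at x) v \<bullet> b) *\<^sub>R
        frechet_derivative f (at (g x)) b)"
    proof (intro ck_on_sum ck_on_bounded_bilinear[OF _ _ assms(3) bounded_bilinear_scaleR] assms(3))
      fix b :: 'b
      show "ck_on k S (\<lambda>x. frechet_derivative g (at x) v \<bullet> b)"
        using Suc.prems by (intro ck_on_bounded_linear[OF _ assms(3) bounded_linear_inner_left]) auto
      show "ck_on k S (\<lambda>x. frechet_derivative f (at (g x)) b)"
        using Suc.prems ck_on_Suc_D[OF Suc.prems(2)] by (intro Suc.IH) auto
    qed
    show "(\<Sum>b\<in>Basis. (frechet_derivative g (at x) v \<bullet> b) *\<^sub>R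
        frechet_derivative f (at (g x)) b) = frechet_derivative (\<lambda>x. f (g x)) (at x) v"
      if "x \<in> S" for x
      using frechet_derivative_at[OF D[OF that]]
        frechet_derivative_euclidean_expand[OF df[OF that]] by metis
  qed
  then show ?case
    using D by (auto simp: differentiable_def)
qed

text \<open>The derivative of the reciprocal is a polynomial in the reciprocal and the derivative of
  \<open>f\<close>, so the induction can keep \<open>f\<close> fixed.\<close>

lemma ck_on_inverse:
  fixes f :: "'a::real_normed_vector \<Rightarrow> real"
  assumes "ck_on k S f" "open S" "\<And>x. x \<in> S \<Longrightarrow> f x \<noteq> 0"
  shows "ck_on k S (\<lambda>x. inverse (f x))"
  using assms(1)
proof (induction k)
  case 0
  then show ?case
    using assms(3) by (auto intro: continuous_intros)
next
  case (Suc k)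
  have D: "((\<lambda>x. inverse (f x)) has_derivative
      (\<lambda>v. - (inverse (f x) * frechet_derivative f (at x) v * inverse (f x)))) (at x)"
    if "x \<in> S" for x
    using Suc.prems that assms(3)
    by (intro Deriv.has_derivative_inverse) (auto simp: frechet_derivative_works)
  have inv: "ck_on k S (\<lambda>x. inverse (f x))"
    using Suc ck_on_Suc_D by blast
  have "ck_on k S (\<lambda>x. frechet_derivative (\<lambda>x. inverse (f x)) (at x) v)" for v
  proof (rule ck_on_cong[OF _ assms(2)])
    show "ck_on k S (\<lambda>x. - (inverse (f x) * frechet_derivative f (at x) v * inverse (f x)))"
      using Suc.prems inv
      by (intro ck_on_bounded_linear[OF _ assms(2) bounded_linear_minus[OF bounded_linear_ident]]
          ck_on_bounded_bilinear[OF _ _ assms(2) bounded_bilinear_mult]) auto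
    show "- (inverse (f x) * frechet_derivative f (at x) v * inverse (f x)) =
        frechet_derivative (\<lambda>x. inverse (f x)) (at x) v" if "x \<in> S" for x
      using frechet_derivative_at[OF D[OF that]] by metis
  qed
  then show ?case
    using D by (auto simp: differentiable_def)
qed

section \<open>Closure rules for smooth maps, up to Cramer's rule\<close>

lemma smooth_on_subset: "smooth_on S f \<Longrightarrow> T \<subseteq> S \<Longrightarrow> smooth_on T f"
  unfolding smooth_on_def by (blast intro: ck_on_subset)

lemma smooth_on_cong:
  "smooth_on S f \<Longrightarrow> open S \<Longrightarrow> (\<And>x. x \<in> S \<Longrightarrow> f x = g x) \<Longrightarrow> smooth_on S g"
  unfolding smooth_on_def by (blast intro: ck_on_cong)

lemma smooth_on_const: "smooth_on S (\<lambda>x. c)"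
  unfolding smooth_on_def by (blast intro: ck_on_const)

lemma smooth_on_add: "smooth_on S f \<Longrightarrow> smooth_on S g \<Longrightarrow> open S \<Longrightarrow> smooth_on S (\<lambda>x. f x + g x)"
  unfolding smooth_on_def by (blast intro: ck_on_add)

lemma smooth_on_bounded_linear:
  "smooth_on S f \<Longrightarrow> open S \<Longrightarrow> bounded_linear L \<Longrightarrow> smooth_on S (\<lambda>x. L (f x))"
  unfolding smooth_on_def by (blast intro: ck_on_bounded_linear)

lemma smooth_on_bounded_bilinear:
  "smooth_on S f \<Longrightarrow> smooth_on S g \<Longrightarrow> open S \<Longrightarrow> bounded_bilinear B \<Longrightarrow>
    smooth_on S (\<lambda>x. B (f x) (g x))"
  unfolding smooth_on_def by (blast intro: ck_on_bounded_bilinear)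

lemma smooth_on_mult:
  fixes f g :: "'a::real_normed_vector \<Rightarrow> real"
  shows "smooth_on S f \<Longrightarrow> smooth_on S g \<Longrightarrow> open S \<Longrightarrow> smooth_on S (\<lambda>x. f x * g x)"
  by (rule smooth_on_bounded_bilinear[OF _ _ _ bounded_bilinear_mult])

lemma smooth_on_scaleR:
  "smooth_on S f \<Longrightarrow> smooth_on S g \<Longrightarrow> open S \<Longrightarrow> smooth_on S (\<lambda>x. f x *\<^sub>R g x)"
  by (rule smooth_on_bounded_bilinear[OF _ _ _ bounded_bilinear_scaleR])

lemma smooth_on_sum:
  "(\<And>i. i \<in> I \<Longrightarrow> smooth_on S (f i)) \<Longrightarrow> open S \<Longrightarrow> smooth_on S (\<lambda>x. \<Sum>i\<in>I. f i x)"
  unfolding smooth_on_def by (blast intro: ck_on_sum)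

lemma smooth_on_prod:
  fixes f :: "'i \<Rightarrow> 'a::real_normed_vector \<Rightarrow> real"
  assumes "\<And>i. i \<in> I \<Longrightarrow> smooth_on S (f i)" "open S"
  shows "smooth_on S (\<lambda>x. \<Prod>i\<in>I. f i x)"
  using assms(1)
  by (induction I rule: infinite_finite_induct)
    (auto intro: smooth_on_const smooth_on_mult assms(2))

lemma smooth_on_compose:
  fixes g :: "'a::real_normed_vector \<Rightarrow> 'b::euclidean_space"
  shows "smooth_on T f \<Longrightarrow> smooth_on S g \<Longrightarrow> open S \<Longrightarrow> open T \<Longrightarrow> g ` S \<subseteq> T \<Longrightarrow>
    smooth_on S (\<lambda>x. f (g x))"
  unfolding smooth_on_def by (blast intro: ck_on_compose)

lemma smooth_on_divide:
  fixes f g :: "'a::real_normed_vector \<Rightarrow> real"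
  assumes "smooth_on S f" "smooth_on S g" "open S" "\<And>x. x \<in> S \<Longrightarrow> g x \<noteq> 0"
  shows "smooth_on S (\<lambda>x. f x / g x)"
  unfolding divide_inverse using assms
  by (intro smooth_on_mult) (auto simp: smooth_on_def intro: ck_on_inverse)

lemma smooth_on_id: "open S \<Longrightarrow> smooth_on S (\<lambda>x. x)"
  unfolding smooth_on_def
proof
  fix k
  assume "open S"
  show "ck_on k S (\<lambda>x. x)"
    by (cases k) (auto simp: ck_on_const continuous_on_id frechet_derivative_ident)
qed

lemma smooth_on_differentiable: "smooth_on S f \<Longrightarrow> x \<in> S \<Longrightarrow> f differentiable (at x)"
  unfolding smooth_on_def using ck_on.simps(2) by blast

lemma smooth_on_has_derivative:
  "smooth_on S f \<Longrightarrow> x \<in> S \<Longrightarrow> (f has_derivative frechet_derivative f (at x)) (at x)"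
  using smooth_on_differentiable frechet_derivative_works by blast

text \<open>In contrast to \<open>ck_on\<close>, the direction may move with the point, as the value
  of a vector field does.\<close>

lemma smooth_on_frechet_derivative:
  fixes f :: "'a::euclidean_space \<Rightarrow> 'b::real_normed_vector"
  assumes "smooth_on S f" "smooth_on S w" "open S"
  shows "smooth_on S (\<lambda>x. frechet_derivative f (at x) (w x))"
proof (rule smooth_on_cong[OF _ assms(3)])
  have d: "smooth_on S (\<lambda>x. frechet_derivative f (at x) b)" for b
    using assms(1) unfolding smooth_on_def using ck_on.simps(2) by blast
  show "smooth_on S (\<lambda>x. \<Sum>b\<in>Basis. (w x \<bullet> b) *\<^sub>R frechet_derivative f (at x) b)"
    by (intro smooth_on_sum[OF _ assms(3)] smooth_on_scaleR[OF _ d assms(3)]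
        smooth_on_bounded_linear[OF assms(2,3) bounded_linear_inner_left])
  show "(\<Sum>b\<in>Basis. (w x \<bullet> b) *\<^sub>R frechet_derivative f (at x) b) =
      frechet_derivative f (at x) (w x)" if "x \<in> S" for x
    using frechet_derivative_euclidean_expand[OF smooth_on_differentiable[OF assms(1) that]] by metis
qed

lemma smooth_on_Pair:
  assumes "smooth_on S f" "smooth_on S g" "open S"
  shows "smooth_on S (\<lambda>x. (f x, g x))"
proof -
  have "smooth_on S (\<lambda>x. (f x, 0) + (0, g x))"
    by (intro smooth_on_add assms(3) smooth_on_bounded_linear[OF assms(1,3), of "\<lambda>x. (x, 0)"]
        smooth_on_bounded_linear[OF assms(2,3), of "\<lambda>x. (0, x)"] bounded_linear_Pair
        bounded_linear_ident bounded_linear_zero)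
  then show ?thesis
    by simp
qed

lemma smooth_on_det:
  fixes A :: "'a::real_normed_vector \<Rightarrow> real ^ 'n ^ 'n"
  assumes "\<And>i j. smooth_on S (\<lambda>x. A x $ i $ j)" "open S"
  shows "smooth_on S (\<lambda>x. det (A x))"
  unfolding det_def
  by (intro smooth_on_sum smooth_on_mult smooth_on_const smooth_on_prod assms)

text \<open>The function \<open>y\<close> is known only pointwise, as a solution. A nonzero
  determinant forces it to be Cramer's quotient of determinants, and these are polynomials in the
  smooth entries.\<close>

lemma smooth_on_linear_solve:
  fixes A :: "'a::real_normed_vector \<Rightarrow> real ^ 'n ^ 'n"
  assumes "\<And>i j. smooth_on S (\<lambda>x. A x $ i $ j)" "\<And>i. smooth_on S (\<lambda>x. b x $ i)" "open S"
    and det: "\<And>x. x \<in> S \<Longrightarrow> det (A x) \<noteq> 0"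
    and solves: "\<And>x. x \<in> S \<Longrightarrow> A x *v y x = b x"
  shows "smooth_on S (\<lambda>x. y x $ k)"
proof (rule smooth_on_cong[OF _ assms(3)])
  show "smooth_on S (\<lambda>x. det (\<chi> i j. if j = k then b x $ i else A x $ i $ j) / det (A x))"
  proof (intro smooth_on_divide smooth_on_det assms)
    show "smooth_on S (\<lambda>x. (\<chi> i j. if j = k then b x $ i else A x $ i $ j) $ i $ j)" for i j
      using assms(1,2) by (cases "j = k") simp_all
  qed
  fix x assume "x \<in> S"
  then show "det (\<chi> i j. if j = k then b x $ i else A x $ i $ j) / det (A x) = y x $ k"
    using cramer[OF det, of x "y x" "b x"] solves by simp
qed

section \<open>Charts and transition derivatives\<close>

lemma is_chartD:
  assumes "is_chart c"
  shows "open (fst c)" "open (snd c ` fst c)" "inj_on (snd c) (fst c)"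
    "continuous_on (fst c) (snd c)" "continuous_on (snd c ` fst c) (param c)"
  using assms by (auto simp: is_chart_def)

lemma param_chart: "is_chart c \<Longrightarrow> p \<in> fst c \<Longrightarrow> param c (snd c p) = p"
  by (simp add: is_chart_def param_def)

lemma chart_param: "x \<in> snd c ` fst c \<Longrightarrow> snd c (param c x) = x"
  by (simp add: param_def f_inv_into_f)

lemma param_in: "x \<in> snd c ` fst c \<Longrightarrow> param c x \<in> fst c"
  by (simp add: param_def inv_into_into)

lemma open_chart_image:
  assumes "is_chart c" "open U"
  shows "open (snd c ` (fst c \<inter> U))"
proof -
  have "snd c ` (fst c \<inter> U) = snd c ` fst c \<inter> param c -` U"
    using param_chart[OF assms(1)] by force
  then show ?thesis
    using continuous_open_preimage[OF is_chartD(5)[OF assms(1)] is_chartD(2)[OF assms(1)] assms(2)]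
    by simp
qed

text \<open>Allowing two arbitrary charts, where \<open>to_chart\<close> and
  \<open>from_chart\<close> always involve the chosen one, makes it possible to state the cocycle
  rule for coordinate changes.\<close>

definition trans_deriv :: "('a, 'b::euclidean_space) chart \<Rightarrow> ('a, 'b) chart \<Rightarrow> 'a \<Rightarrow> 'b \<Rightarrow> 'b" where
  "trans_deriv c d p = frechet_derivative (snd d \<circ> param c) (at (snd c p))"

lemma to_chart_eq: "to_chart M c p = trans_deriv (chart_at M p) c p"
  by (simp add: to_chart_def trans_deriv_def)

lemma from_chart_eq: "from_chart M c p = trans_deriv c (chart_at M p) p"
  by (simp add: from_chart_def trans_deriv_def)

locale manifold =
  fixes M :: "('a::{t2_space,second_countable_topology}, 'b::euclidean_space) atlas"
  assumes smooth_manifold: "smooth_manifold M"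
begin

lemma is_chart: "c \<in> M \<Longrightarrow> is_chart c"
  using smooth_manifold by (simp add: smooth_manifold_def)

lemmas open_domain = is_chartD(1)[OF is_chart]
  and open_image = is_chartD(2)[OF is_chart]
  and param_chart = param_chart[OF is_chart]

lemma chart_at: "chart_at M p \<in> M" "p \<in> fst (chart_at M p)"
proof -
  have "\<exists>c. c \<in> M \<and> p \<in> fst c"
    using smooth_manifold UNIV_I[of p] unfolding smooth_manifold_def by blast
  then have "chart_at M p \<in> M \<and> p \<in> fst (chart_at M p)"
    unfolding chart_at_def by (rule someI_ex)
  then show "chart_at M p \<in> M" "p \<in> fst (chart_at M p)"
    by auto
qed

lemma smooth_transition:
  "c \<in> M \<Longrightarrow> d \<in> M \<Longrightarrow> smooth_on (snd c ` (fst c \<inter> fst d)) (snd d \<circ> param c)"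
  using smooth_manifold by (simp add: smooth_manifold_def)

lemma open_overlap: "c \<in> M \<Longrightarrow> d \<in> M \<Longrightarrow> open (snd c ` (fst c \<inter> fst d))"
  by (simp add: open_chart_image is_chart open_domain)

lemma transition_has_derivative:
  assumes "c \<in> M" "d \<in> M" "p \<in> fst c" "p \<in> fst d"
  shows "((snd d \<circ> param c) has_derivative trans_deriv c d p) (at (snd c p))"
  unfolding trans_deriv_def
  by (rule smooth_on_has_derivative[OF smooth_transition[OF assms(1,2)]]) (use assms in auto)

lemma linear_trans_deriv:
  assumes "c \<in> M" "d \<in> M" "p \<in> fst c" "p \<in> fst d"
  shows "linear (trans_deriv c d p)"
  using transition_has_derivative[OF assms] by (rule has_derivative_linear)

lemma has_derivative_change_chart:
  assumes cd: "c \<in> M" "d \<in> M" "p \<in> fst c" "p \<in> fst d"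
    and f: "((f \<circ> param d) has_derivative D) (at (snd d p))"
  shows "((f \<circ> param c) has_derivative (\<lambda>v. D (trans_deriv c d p v))) (at (snd c p))"
proof -
  have "(snd d \<circ> param c) (snd c p) = snd d p"
    using cd by (simp add: param_chart)
  then have D: "((f \<circ> param d) \<circ> (snd d \<circ> param c) has_derivative D \<circ> trans_deriv c d p) (at (snd c p))"
    using diff_chain_at[OF transition_has_derivative[OF cd], of "f \<circ> param d" D] f by simp
  have "(f \<circ> param c has_derivative D \<circ> trans_deriv c d p) (at (snd c p))"
  proof (rule has_derivative_transform_within_open[OF D open_overlap[OF cd(1,2)]])
    show "snd c p \<in> snd c ` (fst c \<inter> fst d)"
      using cd by auto
    show "((f \<circ> param d) \<circ> (snd d \<circ> param c)) x = (f \<circ> param c) x"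
      if "x \<in> snd c ` (fst c \<inter> fst d)" for x
      using that cd by (auto simp: param_chart)
  qed
  then show ?thesis
    by (simp add: o_def)
qed

lemma frechet_derivative_change_chart:
  assumes "c \<in> M" "d \<in> M" "p \<in> fst c" "p \<in> fst d" "(f \<circ> param d) differentiable (at (snd d p))"
  shows "frechet_derivative (f \<circ> param c) (at (snd c p)) v =
    frechet_derivative (f \<circ> param d) (at (snd d p)) (trans_deriv c d p v)"
  using frechet_derivative_at[OF has_derivative_change_chart[OF assms(1-4)
      assms(5)[unfolded frechet_derivative_works]]] by metis

text \<open>Chain rule applied to the coordinate map of the third chart. Together with
  \<open>trans_deriv_self\<close> it makes \<open>to_chart\<close> and \<open>from_chart\<close>
  inverse to each other.\<close>

lemma trans_deriv_trans:
  assumes "c \<in> M" "d \<in> M" "b \<in> M" "p \<in> fst c" "p \<in> fst d" "p \<in> fst b"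
  shows "trans_deriv d b p (trans_deriv c d p v) = trans_deriv c b p v"
proof -
  have "(snd b \<circ> param d) differentiable (at (snd d p))"
    using transition_has_derivative[of d b p] assms differentiable_def by blast
  then show ?thesis
    using frechet_derivative_change_chart[of c d p "snd b" v] assms by (simp add: trans_deriv_def)
qed

lemma trans_deriv_self:
  assumes "c \<in> M" "p \<in> fst c"
  shows "trans_deriv c c p v = v"
proof -
  have "frechet_derivative (snd c \<circ> param c) (at (snd c p)) =
      frechet_derivative (\<lambda>x. x) (at (snd c p))"
    by (rule frechet_derivative_cong_open[OF open_image[OF assms(1)]])
      (use assms in \<open>auto simp: param_chart\<close>)
  then show ?thesis
    by (simp add: trans_deriv_def)
qed

lemma linear_to_chart: "c \<in> M \<Longrightarrow> p \<in> fst c \<Longrightarrow> linear (to_chart M c p)"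
  by (simp add: to_chart_eq linear_trans_deriv chart_at)

lemma linear_from_chart: "c \<in> M \<Longrightarrow> p \<in> fst c \<Longrightarrow> linear (from_chart M c p)"
  by (simp add: from_chart_eq linear_trans_deriv chart_at)

lemma to_from_chart: "c \<in> M \<Longrightarrow> p \<in> fst c \<Longrightarrow> to_chart M c p (from_chart M c p v) = v"
  by (simp add: from_chart_eq to_chart_eq trans_deriv_trans chart_at trans_deriv_self)

lemma from_to_chart: "c \<in> M \<Longrightarrow> p \<in> fst c \<Longrightarrow> from_chart M c p (to_chart M c p v) = v"
  by (simp add: from_chart_eq to_chart_eq trans_deriv_trans chart_at trans_deriv_self)

lemma to_chart_chart_at: "to_chart M (chart_at M p) p v = v"
  by (simp add: to_chart_eq chart_at trans_deriv_self)


section \<open>Smooth functions and vector fields\<close>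

lemma smooth_fun_const: "smooth_fun M (\<lambda>p. k)"
  by (simp add: smooth_fun_def o_def smooth_on_const)

lemma smooth_fun_add: "smooth_fun M f \<Longrightarrow> smooth_fun M g \<Longrightarrow> smooth_fun M (\<lambda>p. f p + g p)"
  by (simp add: smooth_fun_def o_def smooth_on_add open_image)

lemma smooth_fun_mult: "smooth_fun M f \<Longrightarrow> smooth_fun M g \<Longrightarrow> smooth_fun M (\<lambda>p. f p * g p)"
  by (simp add: smooth_fun_def o_def smooth_on_mult open_image)

lemma smooth_fun_sum:
  "(\<And>i. i \<in> I \<Longrightarrow> smooth_fun M (f i)) \<Longrightarrow> smooth_fun M (\<lambda>p. \<Sum>i\<in>I. f i p)"
  by (simp add: smooth_fun_def o_def smooth_on_sum open_image)

lemma smooth_fun_has_derivative: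
  assumes "smooth_fun M f" "c \<in> M" "p \<in> fst c"
  shows "((f \<circ> param c) has_derivative frechet_derivative (f \<circ> param c) (at (snd c p))) (at (snd c p))"
  using assms by (intro smooth_on_has_derivative[of "snd c ` fst c"]) (auto simp: smooth_fun_def)

text \<open>The constant function \<open>\<lambda>_. v\<close> is not meant as a field on the
  manifold: \<open>vf_apply\<close> reads it at \<open>p\<close> only, so it stands for the tangent
  vector \<open>v\<close> at \<open>p\<close>.\<close>

lemma smooth_fun_vf_has_derivative:
  assumes "smooth_fun M f"
  shows "((f \<circ> param (chart_at M p)) has_derivative
    (\<lambda>v. vf_apply M (\<lambda>_. v) f p)) (at (snd (chart_at M p) p))"
  using smooth_fun_has_derivative[OF assms chart_at] by (simp add: vf_apply_def)

lemma vf_apply_eqI: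
  assumes "((f \<circ> param (chart_at M p)) has_derivative D) (at (snd (chart_at M p) p))"
  shows "vf_apply M X f p = D (X p)"
  using frechet_derivative_at[OF assms] by (simp add: vf_apply_def)

lemma vf_apply_const: "vf_apply M X (\<lambda>p. k) p = 0"
  by (simp add: vf_apply_def o_def)

lemma vf_apply_add:
  assumes "smooth_fun M f" "smooth_fun M g"
  shows "vf_apply M X (\<lambda>p. f p + g p) p = vf_apply M X f p + vf_apply M X g p"
  using vf_apply_eqI[of "\<lambda>p. f p + g p" p, unfolded o_def, OF has_derivative_add[OF
      smooth_fun_vf_has_derivative[OF assms(1), unfolded o_def]
      smooth_fun_vf_has_derivative[OF assms(2), unfolded o_def]]]
  by (simp add: vf_apply_def o_def)

lemma vf_apply_mult:
  assumes "smooth_fun M f" "smooth_fun M g"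
  shows "vf_apply M X (\<lambda>p. f p * g p) p = f p * vf_apply M X g p + vf_apply M X f p * g p"
proof -
  let ?c = "chart_at M p"
  have "((\<lambda>x. (f \<circ> param ?c) x * (g \<circ> param ?c) x) has_derivative
      (\<lambda>v. (f \<circ> param ?c) (snd ?c p) * vf_apply M (\<lambda>_. v) g p +
        vf_apply M (\<lambda>_. v) f p * (g \<circ> param ?c) (snd ?c p))) (at (snd ?c p))"
    by (intro has_derivative_mult smooth_fun_vf_has_derivative assms)
  then show ?thesis
    using vf_apply_eqI[of "\<lambda>p. f p * g p" p _ X]
    by (simp add: o_def param_chart chart_at vf_apply_def)
qed

lemma vf_apply_sum:
  assumes "\<And>i. i \<in> I \<Longrightarrow> smooth_fun M (f i)"
  shows "vf_apply M X (\<lambda>p. \<Sum>i\<in>I. f i p) p = (\<Sum>i\<in>I. vf_apply M X (f i) p)"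
  using assms
  by (induction I rule: infinite_finite_induct)
    (simp_all add: vf_apply_const vf_apply_add smooth_fun_sum)

lemma vf_apply_field_linear:
  assumes "smooth_fun M f"
  shows "linear (\<lambda>v. vf_apply M (\<lambda>_. v) f p)"
  using has_derivative_linear[OF smooth_fun_vf_has_derivative[OF assms]] .

text \<open>\<open>vf_apply\<close> is defined in the chart chosen at \<open>p\<close>, which
  changes with \<open>p\<close> without any continuity. Smoothness in \<open>p\<close> becomes
  accessible in a chart that stays fixed.\<close>

lemma vf_apply_in_chart:
  assumes "smooth_fun M f" "c \<in> M" "p \<in> fst c"
  shows "vf_apply M X f p = frechet_derivative (f \<circ> param c) (at (snd c p)) (to_chart M c p (X p))"
  unfolding vf_apply_def to_chart_eq
  using assms smooth_fun_has_derivative[OF assms]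
  by (intro frechet_derivative_change_chart chart_at) (auto simp: differentiable_def)

lemma smooth_fun_vf_apply:
  assumes "smooth_vf M X" "smooth_fun M f"
  shows "smooth_fun M (vf_apply M X f)"
  unfolding smooth_fun_def
proof
  fix c assume c: "c \<in> M"
  show "smooth_on (snd c ` fst c) (vf_apply M X f \<circ> param c)"
  proof (rule smooth_on_cong[OF _ open_image[OF c]])
    show "smooth_on (snd c ` fst c)
        (\<lambda>x. frechet_derivative (f \<circ> param c) (at x) (field_in_chart M c X x))"
      using assms c by (intro smooth_on_frechet_derivative open_image)
        (auto simp: smooth_fun_def smooth_vf_def)
    fix x assume "x \<in> snd c ` fst c"
    then show "frechet_derivative (f \<circ> param c) (at x) (field_in_chart M c X x) =
        (vf_apply M X f \<circ> param c) x"
      using vf_apply_in_chart[OF assms(2) c param_in, of x X]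
      by (simp add: field_in_chart_def chart_param)
  qed
qed

section \<open>Chart components of vector fields\<close>

lemma field_in_chart_add:
  "c \<in> M \<Longrightarrow> x \<in> snd c ` fst c \<Longrightarrow>
    field_in_chart M c (\<lambda>p. X p + Y p) x = field_in_chart M c X x + field_in_chart M c Y x"
  by (simp only: field_in_chart_def linear_add[OF linear_to_chart] param_in)

lemma field_in_chart_scaleR:
  "c \<in> M \<Longrightarrow> x \<in> snd c ` fst c \<Longrightarrow>
    field_in_chart M c (\<lambda>p. f p *\<^sub>R X p) x = (f \<circ> param c) x *\<^sub>R field_in_chart M c X x"
  by (simp only: field_in_chart_def linear_scale[OF linear_to_chart] param_in o_def)

lemma field_in_chart_at: "field_in_chart M (chart_at M p) X (snd (chart_at M p) p) = X p"
  by (simp add: field_in_chart_def param_chart chart_at to_chart_chart_at)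

lemma smooth_vf_add: "smooth_vf M X \<Longrightarrow> smooth_vf M Y \<Longrightarrow> smooth_vf M (\<lambda>p. X p + Y p)"
  unfolding smooth_vf_def
proof
  fix c assume "\<forall>c\<in>M. smooth_on (snd c ` fst c) (field_in_chart M c X)"
    "\<forall>c\<in>M. smooth_on (snd c ` fst c) (field_in_chart M c Y)" and c: "c \<in> M"
  then have "smooth_on (snd c ` fst c) (\<lambda>x. field_in_chart M c X x + field_in_chart M c Y x)"
    by (simp add: smooth_on_add open_image)
  then show "smooth_on (snd c ` fst c) (field_in_chart M c (\<lambda>p. X p + Y p))"
    by (rule smooth_on_cong) (simp_all add: c open_image field_in_chart_add)
qed

lemma smooth_vf_scaleR: "smooth_fun M f \<Longrightarrow> smooth_vf M X \<Longrightarrow> smooth_vf M (\<lambda>p. f p *\<^sub>R X p)"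
  unfolding smooth_vf_def smooth_fun_def
proof
  fix c assume "\<forall>c\<in>M. smooth_on (snd c ` fst c) (f \<circ> param c)"
    "\<forall>c\<in>M. smooth_on (snd c ` fst c) (field_in_chart M c X)" and c: "c \<in> M"
  then have "smooth_on (snd c ` fst c) (\<lambda>x. (f \<circ> param c) x *\<^sub>R field_in_chart M c X x)"
    using smooth_on_scaleR[of "snd c ` fst c" "f \<circ> param c" "field_in_chart M c X"] open_image[OF c]
    by simp
  then show "smooth_on (snd c ` fst c) (field_in_chart M c (\<lambda>p. f p *\<^sub>R X p))"
    by (rule smooth_on_cong) (simp_all add: c open_image field_in_chart_scaleR)
qed

lemma smooth_vf_zero: "smooth_vf M (\<lambda>p. 0)"
  unfolding smooth_vf_def
proof
  fix c assume c: "c \<in> M"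
  show "smooth_on (snd c ` fst c) (field_in_chart M c (\<lambda>p. 0))"
    by (rule smooth_on_cong[OF smooth_on_const[where c = 0]])
      (simp_all add: c open_image field_in_chart_def linear_0[OF linear_to_chart] param_in)
qed

lemma smooth_vf_sum:
  "(\<And>i. i \<in> I \<Longrightarrow> smooth_vf M (X i)) \<Longrightarrow> smooth_vf M (\<lambda>p. \<Sum>i\<in>I. X i p)"
  by (induction I rule: infinite_finite_induct) (auto intro: smooth_vf_zero smooth_vf_add)

lemma field_has_derivative:
  assumes "smooth_vf M X" "c \<in> M" "p \<in> fst c"
  shows "(field_in_chart M c X has_derivative
    frechet_derivative (field_in_chart M c X) (at (snd c p))) (at (snd c p))"
  using assms by (intro smooth_on_has_derivative[of "snd c ` fst c"]) (auto simp: smooth_vf_def)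

lemma field_derivative_add:
  assumes "smooth_vf M X" "smooth_vf M Y" "c \<in> M" "p \<in> fst c"
  shows "frechet_derivative (field_in_chart M c (\<lambda>p. X p + Y p)) (at (snd c p)) v =
    frechet_derivative (field_in_chart M c X) (at (snd c p)) v +
    frechet_derivative (field_in_chart M c Y) (at (snd c p)) v"
proof -
  have "frechet_derivative (field_in_chart M c (\<lambda>p. X p + Y p)) (at (snd c p)) =
      frechet_derivative (\<lambda>x. field_in_chart M c X x + field_in_chart M c Y x) (at (snd c p))"
    by (rule frechet_derivative_cong_open[OF open_image[OF assms(3)]])
      (use assms field_in_chart_add in auto)
  then show ?thesis
    using frechet_derivative_at[OF has_derivative_add[OF field_has_derivative[OF assms(1,3,4)]
          field_has_derivative[OF assms(2,3,4)]]] by metis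
qed

text \<open>Stated in the chart chosen at \<open>p\<close> because \<open>vf_apply\<close> and
  \<open>lie_bracket\<close> are both computed there.\<close>

lemma field_derivative_scaleR:
  assumes "smooth_fun M f" "smooth_vf M X"
  shows "frechet_derivative (field_in_chart M (chart_at M p) (\<lambda>p. f p *\<^sub>R X p))
      (at (snd (chart_at M p) p)) v =
    vf_apply M (\<lambda>_. v) f p *\<^sub>R X p +
    f p *\<^sub>R frechet_derivative (field_in_chart M (chart_at M p) X) (at (snd (chart_at M p) p)) v"
proof -
  let ?c = "chart_at M p"
  let ?F = "field_in_chart M ?c" and ?x = "snd ?c p"
  have "frechet_derivative (?F (\<lambda>p. f p *\<^sub>R X p)) (at ?x) =
      frechet_derivative (\<lambda>x. (f \<circ> param ?c) x *\<^sub>R ?F X x) (at ?x)"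
    by (rule frechet_derivative_cong_open[OF open_image[OF chart_at(1)[of p]]])
      (simp_all add: chart_at imageI field_in_chart_scaleR)
  moreover have D: "((\<lambda>x. (f \<circ> param ?c) x *\<^sub>R ?F X x) has_derivative
      (\<lambda>v. (f \<circ> param ?c) ?x *\<^sub>R frechet_derivative (?F X) (at ?x) v +
        vf_apply M (\<lambda>_. v) f p *\<^sub>R ?F X ?x)) (at ?x)"
    by (intro has_derivative_scaleR smooth_fun_vf_has_derivative field_has_derivative assms chart_at)
  ultimately show ?thesis
    using frechet_derivative_at[OF D, symmetric]
    by (simp add: param_chart chart_at field_in_chart_at)
qed

section \<open>Leibniz rules for the Lie bracket, and endomorphisms acting on fields\<close>

lemma lie_bracket_swap: "lie_bracket M X Y p = - lie_bracket M Y X p"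
  by (simp add: lie_bracket_def Let_def)

lemma lie_bracket_add:
  assumes "smooth_vf M X" "smooth_vf M Y" "smooth_vf M Z"
  shows "lie_bracket M X (\<lambda>p. Y p + Z p) p = lie_bracket M X Y p + lie_bracket M X Z p"
proof -
  have "linear (frechet_derivative (field_in_chart M (chart_at M p) X) (at (snd (chart_at M p) p)))"
    using field_has_derivative[OF assms(1) chart_at] has_derivative_linear by blast
  then show ?thesis
    by (simp add: lie_bracket_def Let_def field_derivative_add[OF assms(2,3) chart_at] linear_add)
qed

lemma lie_bracket_scaleR:
  assumes "smooth_vf M X" "smooth_fun M f" "smooth_vf M Y"
  shows "lie_bracket M X (\<lambda>p. f p *\<^sub>R Y p) p = vf_apply M X f p *\<^sub>R Y p + f p *\<^sub>R lie_bracket M X Y p"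
proof -
  have "linear (frechet_derivative (field_in_chart M (chart_at M p) X) (at (snd (chart_at M p) p)))"
    using field_has_derivative[OF assms(1) chart_at] has_derivative_linear by blast
  then show ?thesis
    using assms by (simp add: lie_bracket_def Let_def field_derivative_scaleR linear_scale
        vf_apply_def scaleR_diff_right)
qed

lemma lie_bracket_zero:
  assumes "smooth_vf M X"
  shows "lie_bracket M X (\<lambda>p. 0) p = 0"
  using lie_bracket_scaleR[OF assms smooth_fun_const[of 0] smooth_vf_zero]
  by (simp add: vf_apply_const)

lemma lie_bracket_sum:
  assumes "smooth_vf M X" "\<And>i. i \<in> I \<Longrightarrow> smooth_vf M (Y i)"
  shows "lie_bracket M X (\<lambda>p. \<Sum>i\<in>I. Y i p) p = (\<Sum>i\<in>I. lie_bracket M X (Y i) p)"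
  using assms(2)
  by (induction I rule: infinite_finite_induct)
    (simp_all add: lie_bracket_zero lie_bracket_add assms(1) smooth_vf_sum)

text \<open>\<open>smooth_endo_on\<close> tests \<open>S\<close> on vectors with constant chart
  components. The components of \<open>X\<close> are therefore split along the basis and enter as
  smooth coefficients.\<close>

lemma smooth_vf_endo_apply:
  assumes "smooth_endo_on M UNIV S" "smooth_vf M X"
  shows "smooth_vf M (endo_apply S X)"
  unfolding smooth_vf_def
proof
  fix c assume c: "c \<in> M"
  let ?S = "\<lambda>b x. to_chart M c (param c x) (S (param c x) (from_chart M c (param c x) b))"
  show "smooth_on (snd c ` fst c) (field_in_chart M c (endo_apply S X))"
  proof (rule smooth_on_cong[OF _ open_image[OF c]])
    have X: "smooth_on (snd c ` fst c) (field_in_chart M c X)"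
      using assms(2) c by (simp add: smooth_vf_def)
    show "smooth_on (snd c ` fst c) (\<lambda>x. \<Sum>b\<in>Basis. (field_in_chart M c X x \<bullet> b) *\<^sub>R ?S b x)"
    proof (intro smooth_on_sum smooth_on_scaleR open_image c)
      show "smooth_on (snd c ` fst c) (\<lambda>x. field_in_chart M c X x \<bullet> b)" for b
        by (rule smooth_on_bounded_linear[OF X open_image[OF c] bounded_linear_inner_left])
      show "smooth_on (snd c ` fst c) (?S b)" for b
        using assms(1) c by (simp add: smooth_endo_on_def Let_def)
    qed
    fix x assume x: "x \<in> snd c ` fst c"
    define p where "p = param c x"
    have p: "p \<in> fst c"
      using x by (simp add: p_def param_in)
    have l: "linear (\<lambda>v. to_chart M c p (S p (from_chart M c p v)))"
      using linear_compose[OF linear_compose[OF linear_from_chart[OF c p]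
            bounded_linear.linear[OF blinfun.bounded_linear_right[of "S p"]]] linear_to_chart[OF c p]]
      by (simp add: o_def)
    have "X p = from_chart M c p (field_in_chart M c X x)"
      using from_to_chart[OF c p] by (simp add: field_in_chart_def p_def)
    also have "field_in_chart M c X x = (\<Sum>b\<in>Basis. (field_in_chart M c X x \<bullet> b) *\<^sub>R b)"
      by (simp add: euclidean_representation)
    finally have "to_chart M c p (S p (X p)) = (\<Sum>b\<in>Basis. (field_in_chart M c X x \<bullet> b) *\<^sub>R
        to_chart M c p (S p (from_chart M c p b)))"
      by (simp only: linear_sum[OF l] linear_scale[OF l])
    then show "(\<Sum>b\<in>Basis. (field_in_chart M c X x \<bullet> b) *\<^sub>R ?S b x) =
        field_in_chart M c (endo_apply S X) x"
      by (simp add: field_in_chart_def endo_apply_def p_def)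
  qed
qed

end

section \<open>Tensor calculus in a global frame\<close>

lemma linear_expand:
  fixes L :: "real ^ 'n \<Rightarrow> 'c::real_vector"
  assumes "linear L"
  shows "L x = (\<Sum>i\<in>UNIV. x $ i *\<^sub>R L (axis i 1))"
proof -
  have x: "x = (\<Sum>i\<in>UNIV. x $ i *\<^sub>R axis i 1)"
    using basis_expansion[of x] by (simp add: scalar_mult_eq_scaleR)
  show ?thesis
    using arg_cong[OF x, of L] by (simp only: linear_sum[OF assms] linear_scale[OF assms])
qed

lemma bilinear_expand:
  fixes B :: "real ^ 'n \<Rightarrow> real ^ 'm \<Rightarrow> 'c::real_vector"
  assumes "bilinear B"
  shows "B x y = (\<Sum>i\<in>UNIV. \<Sum>j\<in>UNIV. (x $ i * y $ j) *\<^sub>R B (axis i 1) (axis j 1))"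
proof -
  have l: "linear (\<lambda>x. B x z)" and r: "linear (\<lambda>y. B w y)" for w z
    using assms by (auto simp: bilinear_def)
  have "B x y = (\<Sum>i\<in>UNIV. x $ i *\<^sub>R B (axis i 1) y)"
    by (rule linear_expand[OF l])
  also have "\<dots> = (\<Sum>i\<in>UNIV. x $ i *\<^sub>R (\<Sum>j\<in>UNIV. y $ j *\<^sub>R B (axis i 1) (axis j 1)))"
    by (intro sum.cong refl arg_cong[where f = "(*\<^sub>R) _"] linear_expand[OF r])
  finally show ?thesis
    by (simp add: scaleR_sum_right)
qed

text \<open>Split \<open>x\<close> as y + z with y in \<open>q\<close> and z orthogonal to
  \<open>q\<close>; the assumption makes z orthogonal to \<open>x\<close>, hence to itself.
  Membership is thereby encoded by linear equations, a form that can be differentiated.\<close>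

lemma in_subspace_if_orthogonal_to_complement:
  fixes q :: "'c::euclidean_space set"
  assumes "subspace q" "\<And>z. (\<And>y. y \<in> q \<Longrightarrow> z \<bullet> y = 0) \<Longrightarrow> z \<bullet> x = 0"
  shows "x \<in> q"
proof -
  obtain y z where yz: "y \<in> span q" "\<And>w. w \<in> span q \<Longrightarrow> orthogonal z w" "x = y + z"
    using orthogonal_subspace_decomp_exists[of q x] by blast
  have "span q = q"
    using assms(1) by (simp add: span_eq_iff)
  have "z \<bullet> w = 0" if "w \<in> q" for w
    using yz(2)[OF span_base[OF that]] by (simp add: orthogonal_def)
  then have "z \<bullet> x = 0" "z \<bullet> y = 0"
    using assms(2) yz(2)[OF yz(1)] by (simp_all add: orthogonal_def)
  then have "z = 0"
    using yz(3) by (simp add: inner_add_right)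
  then show ?thesis
    using yz \<open>span q = q\<close> by simp
qed

text \<open>A parallelisation of the manifold. The tensor calculus rests on this alone; the bracket
  relations and the group join later.\<close>

locale frame = manifold M
  for M :: "('a::{t2_space,second_countable_topology}, 'b::euclidean_space) atlas" +
  fixes \<iota> :: "real ^ 'n \<Rightarrow> 'a \<Rightarrow> 'b"
  assumes smooth_frame: "smooth_vf M (\<iota> x)"
    and linear_frame: "linear (\<lambda>x. \<iota> x p)"
    and bij_frame: "bij (\<lambda>x. \<iota> x p)"
begin

lemma left_triv_frame [simp]: "left_triv \<iota> p (\<iota> x p) = x"
  by (simp add: left_triv_def inv_f_f[OF bij_is_inj[OF bij_frame[of p]]])

lemma frame_left_triv [simp]: "\<iota> (left_triv \<iota> p v) p = v"
  using bij_frame[of p] surj_f_inv_f[of "\<lambda>x. \<iota> x p" v] by (simp add: left_triv_def bij_is_surj)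

lemma frame_eq_iff: "\<iota> x p = \<iota> y p \<longleftrightarrow> x = y"
  using left_triv_frame by metis

lemma left_triv_eq_iff: "left_triv \<iota> p u = left_triv \<iota> p v \<longleftrightarrow> u = v"
  using frame_left_triv by metis

lemmas frame_add = linear_add[OF linear_frame]
  and frame_scaleR = linear_scale[OF linear_frame]
  and frame_diff = linear_diff[OF linear_frame]
  and frame_neg = linear_neg[OF linear_frame]
  and frame_sum = linear_sum[OF linear_frame]
  and frame_zero = linear_0[OF linear_frame]

lemma linear_left_triv: "linear (left_triv \<iota> p)"
proof (rule linearI)
  fix u v and r :: real
  have "\<iota> (left_triv \<iota> p (u + v)) p = \<iota> (left_triv \<iota> p u + left_triv \<iota> p v) p"
    by (simp add: frame_add)
  then show "left_triv \<iota> p (u + v) = left_triv \<iota> p u + left_triv \<iota> p v"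
    by (simp only: frame_eq_iff)
  have "\<iota> (left_triv \<iota> p (r *\<^sub>R u)) p = \<iota> (r *\<^sub>R left_triv \<iota> p u) p"
    by (simp add: frame_scaleR)
  then show "left_triv \<iota> p (r *\<^sub>R u) = r *\<^sub>R left_triv \<iota> p u"
    by (simp only: frame_eq_iff)
qed

lemmas left_triv_add = linear_add[OF linear_left_triv]
  and left_triv_scaleR = linear_scale[OF linear_left_triv]
  and left_triv_diff = linear_diff[OF linear_left_triv]
  and left_triv_neg = linear_neg[OF linear_left_triv]
  and left_triv_zero = linear_0[OF linear_left_triv]

lemma frame_expand: "\<iota> x p = (\<Sum>k\<in>UNIV. x $ k *\<^sub>R \<iota> (axis k 1) p)"
  by (rule linear_expand[OF linear_frame])

lemma smooth_vf_frame:
  assumes "\<And>k. smooth_fun M (\<lambda>p. f p $ k)"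
  shows "smooth_vf M (\<lambda>p. \<iota> (f p) p)"
proof -
  have "smooth_vf M (\<lambda>p. \<Sum>k\<in>UNIV. f p $ k *\<^sub>R \<iota> (axis k 1) p)"
    by (intro smooth_vf_sum smooth_vf_scaleR assms smooth_frame)
  moreover have "(\<lambda>p. \<iota> (f p) p) = (\<lambda>p. \<Sum>k\<in>UNIV. f p $ k *\<^sub>R \<iota> (axis k 1) p)"
    by (intro ext frame_expand)
  ultimately show ?thesis
    by simp
qed

text \<open>The frame components of a field solve a linear system whose coefficients are the chart
  components of the frame, so Cramer's rule makes them smooth.\<close>

lemma smooth_on_left_triv:
  assumes c: "c \<in> M" and w: "smooth_on (snd c ` fst c) w"
  shows "smooth_on (snd c ` fst c) (\<lambda>x. left_triv \<iota> (param c x) (from_chart M c (param c x) (w x)) $ k)"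
proof -
  \<comment> \<open>Matrices need coordinates indexed by \<open>'n\<close>, but chart components
    live in the abstract type \<open>'b\<close>. The frame at one arbitrary point supplies a fixed
    linear isomorphism between the two models.\<close>
  define T where "T = left_triv \<iota> (undefined :: 'a)"
  have T: "linear T" "inj T"
    by (auto simp: T_def linear_left_triv inj_def left_triv_eq_iff)
  have bl: "bounded_linear (\<lambda>v. T v $ i)" for i
    using bounded_linear_compose[OF bounded_linear_vec_nth[of i], of T] T(1)
    by (simp add: linear_conv_bounded_linear)
  define L where "L x z = T (field_in_chart M c (\<iota> z) x)" for x z
  have L_eq: "L x = T \<circ> (to_chart M c (param c x) \<circ> (\<lambda>z. \<iota> z (param c x)))" for x
    by (auto simp: L_def field_in_chart_def)
  have lin: "linear (L x)" if "x \<in> snd c ` fst c" for x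
    unfolding L_eq using linear_to_chart[OF c param_in[OF that]]
    by (intro linear_compose T linear_frame)
  have inj: "inj (L x)" if "x \<in> snd c ` fst c" for x
    unfolding L_eq
  proof (intro inj_compose T)
    show "inj (to_chart M c (param c x))"
      by (rule inj_on_inverseI) (rule from_to_chart[OF c param_in[OF that]])
    show "inj (\<lambda>z. \<iota> z (param c x))"
      using bij_frame bij_is_inj by blast
  qed
  show ?thesis
  proof (rule smooth_on_linear_solve[where A = "\<lambda>x. matrix (L x)" and b = "\<lambda>x. T (w x)"])
    show "smooth_on (snd c ` fst c) (\<lambda>x. matrix (L x) $ i $ j)" for i j
      using smooth_on_bounded_linear[OF _ open_image[OF c] bl[of i],
          of "field_in_chart M c (\<iota> (axis j 1))"] smooth_frame[of "axis j 1"] c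
      by (simp add: matrix_def L_def smooth_vf_def)
    show "smooth_on (snd c ` fst c) (\<lambda>x. T (w x) $ i)" for i
      by (rule smooth_on_bounded_linear[OF w open_image[OF c] bl])
    show "open (snd c ` fst c)"
      by (rule open_image[OF c])
    fix x assume x: "x \<in> snd c ` fst c"
    show "det (matrix (L x)) \<noteq> 0"
      using det_nz_iff_inj[OF lin[OF x]] inj[OF x] by simp
    show "matrix (L x) *v left_triv \<iota> (param c x) (from_chart M c (param c x) (w x)) = T (w x)"
      by (simp add: matrix_works[OF lin[OF x, folded linear_matrix_vector_mul_eq]] L_def field_in_chart_def
          to_from_chart[OF c param_in[OF x]])
  qed
qed

lemma smooth_fun_left_triv:
  assumes "smooth_vf M X"
  shows "smooth_fun M (\<lambda>p. left_triv \<iota> p (X p) $ k)"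
  unfolding smooth_fun_def
proof
  fix c assume c: "c \<in> M"
  then have X: "smooth_on (snd c ` fst c) (field_in_chart M c X)"
    using assms by (simp add: smooth_vf_def)
  show "smooth_on (snd c ` fst c) ((\<lambda>p. left_triv \<iota> p (X p) $ k) \<circ> param c)"
    by (rule smooth_on_cong[OF smooth_on_left_triv[OF c X] open_image[OF c]])
      (simp add: field_in_chart_def from_to_chart[OF c param_in])
qed

lemma smooth_fun_bilinear:
  fixes B :: "real ^ 'k \<Rightarrow> real ^ 'm \<Rightarrow> real"
  assumes "bilinear B" "\<And>k. smooth_fun M (\<lambda>p. f p $ k)" "\<And>k. smooth_fun M (\<lambda>p. g p $ k)"
  shows "smooth_fun M (\<lambda>p. B (f p) (g p))"
proof -
  have "smooth_fun M (\<lambda>p. \<Sum>i\<in>UNIV. \<Sum>j\<in>UNIV. f p $ i * g p $ j * B (axis i 1) (axis j 1))"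
    by (intro smooth_fun_sum smooth_fun_mult smooth_fun_const assms)
  then show ?thesis
    by (simp only: bilinear_expand[OF assms(1), of "f _" "g _"] real_scaleR_def)
qed

text \<open>On frame components this is the flat connection for which the frame is parallel; the
  Levi-Civita connection differs from it by an algebraic term.\<close>

definition vec_deriv :: "('a \<Rightarrow> 'b) \<Rightarrow> ('a \<Rightarrow> real ^ 'k) \<Rightarrow> 'a \<Rightarrow> real ^ 'k" where
  "vec_deriv X f p = (\<chi> k. vf_apply M X (\<lambda>q. f q $ k) p)"

abbreviation coeffs :: "('a \<Rightarrow> 'b) \<Rightarrow> 'a \<Rightarrow> real ^ 'n" where
  "coeffs X p \<equiv> left_triv \<iota> p (X p)"

lemma smooth_fun_vec_deriv:
  "smooth_vf M X \<Longrightarrow> (\<And>k. smooth_fun M (\<lambda>p. f p $ k)) \<Longrightarrow> smooth_fun M (\<lambda>p. vec_deriv X f p $ k)"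
  by (simp add: vec_deriv_def smooth_fun_vf_apply)

lemma vf_apply_bilinear:
  fixes B :: "real ^ 'k \<Rightarrow> real ^ 'm \<Rightarrow> real"
  assumes "bilinear B" "\<And>k. smooth_fun M (\<lambda>p. f p $ k)" "\<And>k. smooth_fun M (\<lambda>p. g p $ k)"
  shows "vf_apply M X (\<lambda>q. B (f q) (g q)) p = B (vec_deriv X f p) (g p) + B (f p) (vec_deriv X g p)"
  unfolding bilinear_expand[OF assms(1), of "f _" "g _"]
    bilinear_expand[OF assms(1), of "vec_deriv X f p" "g p"]
    bilinear_expand[OF assms(1), of "f p" "vec_deriv X g p"] real_scaleR_def
  by (simp add: vf_apply_sum vf_apply_mult vf_apply_const smooth_fun_sum smooth_fun_mult
      smooth_fun_const assms vec_deriv_def sum.distrib algebra_simps)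

lemma vec_deriv_add:
  "(\<And>k. smooth_fun M (\<lambda>p. f p $ k)) \<Longrightarrow> (\<And>k. smooth_fun M (\<lambda>p. g p $ k)) \<Longrightarrow>
    vec_deriv X (\<lambda>p. f p + g p) p = vec_deriv X f p + vec_deriv X g p"
  by (simp add: vec_deriv_def vf_apply_add vec_eq_iff)

lemma vec_deriv_scaleR:
  "smooth_fun M r \<Longrightarrow> (\<And>k. smooth_fun M (\<lambda>p. f p $ k)) \<Longrightarrow>
    vec_deriv X (\<lambda>p. r p *\<^sub>R f p) p = vf_apply M X r p *\<^sub>R f p + r p *\<^sub>R vec_deriv X f p"
  by (simp add: vec_deriv_def vf_apply_mult vec_eq_iff)

lemma vec_deriv_field_linear:
  assumes "\<And>k. smooth_fun M (\<lambda>p. f p $ k)"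
  shows "linear (\<lambda>v. vec_deriv (\<lambda>_. v) f p)"
  by (rule linearI)
    (simp_all add: vec_deriv_def vec_eq_iff linear_add[OF vf_apply_field_linear[OF assms]]
      linear_scale[OF vf_apply_field_linear[OF assms]])

text \<open>Freezing the field to its value at \<open>p\<close> turns the linearity in
  \<open>v\<close> shown above into tensoriality of a connection in its first argument.\<close>

lemma vec_deriv_at: "vec_deriv X f p = vec_deriv (\<lambda>_. X p) f p"
  by (simp add: vec_deriv_def vf_apply_def)

lemma vec_deriv_matrix_vector:
  fixes A :: "'a \<Rightarrow> real ^ 'n ^ 'm"
  assumes "\<And>i j. smooth_fun M (\<lambda>p. A p $ i $ j)" "\<And>k. smooth_fun M (\<lambda>p. f p $ k)"
  shows "vec_deriv X (\<lambda>p. A p *v f p) p =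
    (\<chi> i j. vf_apply M X (\<lambda>q. A q $ i $ j) p) *v f p + A p *v vec_deriv X f p"
  by (simp add: vec_eq_iff vec_deriv_def matrix_vector_mult_def vf_apply_sum vf_apply_mult
      smooth_fun_mult assms sum.distrib algebra_simps)

text \<open>Every \<open>Z\<close> orthogonal to \<open>q\<close> gives an equation with constant
  coefficients for the entries of \<open>A\<close>, valid at all points. Differentiating it gives
  the same equation for the derivative.\<close>

lemma vf_apply_matrix_in_subspace:
  fixes q :: "(real ^ 'n ^ 'm) set"
  assumes "subspace q" "\<And>p. A p \<in> q" "\<And>i j. smooth_fun M (\<lambda>p. A p $ i $ j)"
  shows "(\<chi> i j. vf_apply M X (\<lambda>r. A r $ i $ j) p) \<in> q"
proof (rule in_subspace_if_orthogonal_to_complement[OF assms(1)])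
  fix Z assume "\<And>B. B \<in> q \<Longrightarrow> Z \<bullet> B = 0"
  then have "(\<Sum>i\<in>UNIV. \<Sum>j\<in>UNIV. Z $ i $ j * A r $ i $ j) = 0" for r
    using assms(2)[of r] by (auto simp: inner_vec_def)
  then have "vf_apply M X (\<lambda>r. \<Sum>i\<in>UNIV. \<Sum>j\<in>UNIV. Z $ i $ j * A r $ i $ j) p = 0"
    by (simp add: vf_apply_const)
  then show "Z \<bullet> (\<chi> i j. vf_apply M X (\<lambda>r. A r $ i $ j) p) = 0"
    by (simp add: vf_apply_sum vf_apply_mult vf_apply_const smooth_fun_sum smooth_fun_mult
        smooth_fun_const assms(3) inner_vec_def)
qed


section \<open>Endomorphism fields in a global frame\<close>

lemma invariant_endo_apply:
  assumes "linear A"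
  shows "blinfun_apply (invariant_endo \<iota> A p) v = \<iota> (A (left_triv \<iota> p v)) p"
proof -
  have "linear (\<lambda>v. \<iota> (A (left_triv \<iota> p v)) p)"
    using linear_compose[OF linear_compose[OF linear_left_triv assms] linear_frame]
    by (simp add: o_def)
  then show ?thesis
    by (simp add: invariant_endo_def bounded_linear_Blinfun_apply linear_conv_bounded_linear)
qed

lemma left_triv_invariant_endo:
  "linear A \<Longrightarrow> left_triv \<iota> p (blinfun_apply (invariant_endo \<iota> A p) v) = A (left_triv \<iota> p v)"
  by (simp add: invariant_endo_apply)

lemma invariant_endo_scaleR:
  "linear A \<Longrightarrow> invariant_endo \<iota> (\<lambda>x. r *\<^sub>R A x) p = r *\<^sub>R invariant_endo \<iota> A p"
  by (rule blinfun_eqI)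
    (simp add: invariant_endo_apply linear_compose_scale_right scaleR_blinfun.rep_eq frame_scaleR)

lemma invariant_endo_add:
  "linear A \<Longrightarrow> linear B \<Longrightarrow>
    invariant_endo \<iota> (\<lambda>x. A x + B x) p = invariant_endo \<iota> A p + invariant_endo \<iota> B p"
  by (rule blinfun_eqI)
    (simp add: invariant_endo_apply linear_compose_add plus_blinfun.rep_eq frame_add)

lemma invariant_endo_inj:
  assumes "linear A" "linear B" "invariant_endo \<iota> A p = invariant_endo \<iota> B p"
  shows "A = B"
proof
  fix x
  show "A x = B x"
    using left_triv_invariant_endo[OF assms(1), of p "\<iota> x p"]
      left_triv_invariant_endo[OF assms(2), of p "\<iota> x p"] assms(3) by simp
qed

text \<open>Lets the fibres of a bundle be described as linear images of one fixed space of
  matrices.\<close>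

lemma linear_invariant_endo_matrix: "linear (\<lambda>A :: real ^ 'n ^ 'n. invariant_endo \<iota> ((*v) A) p)"
proof (rule linearI)
  fix A B :: "real ^ 'n ^ 'n" and r :: real
  have "(*v) (A + B) = (\<lambda>x. A *v x + B *v x)" "(*v) (r *\<^sub>R A) = (\<lambda>x. r *\<^sub>R (A *v x))"
    by (simp_all add: fun_eq_iff matrix_vector_mult_add_rdistrib scaleR_matrix_vector_assoc)
  then show "invariant_endo \<iota> ((*v) (A + B)) p = invariant_endo \<iota> ((*v) A) p + invariant_endo \<iota> ((*v) B) p"
    "invariant_endo \<iota> ((*v) (r *\<^sub>R A)) p = r *\<^sub>R invariant_endo \<iota> ((*v) A) p"
    by (simp_all add: invariant_endo_add invariant_endo_scaleR)
qed

definition endo_matrix :: "('a \<Rightarrow> 'b \<Rightarrow>\<^sub>L 'b) \<Rightarrow> 'a \<Rightarrow> real ^ 'n ^ 'n" where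
  "endo_matrix S p = matrix (\<lambda>x. left_triv \<iota> p (blinfun_apply (S p) (\<iota> x p)))"

lemma endo_matrix_vector: "endo_matrix S p *v x = left_triv \<iota> p (blinfun_apply (S p) (\<iota> x p))"
proof -
  have "linear (\<lambda>x. left_triv \<iota> p (blinfun_apply (S p) (\<iota> x p)))"
    using linear_compose[OF linear_compose[OF linear_frame[of p]
          bounded_linear.linear[OF blinfun.bounded_linear_right[of "S p"]]] linear_left_triv]
    by (simp add: o_def)
  then show ?thesis
    by (simp add: endo_matrix_def)
qed

lemma endo_matrix_eq: "S p = invariant_endo \<iota> ((*v) B) p \<Longrightarrow> endo_matrix S p = B"
  by (simp add: matrix_eq endo_matrix_vector left_triv_invariant_endo)

lemma coeffs_endo_apply: "coeffs (endo_apply S X) p = endo_matrix S p *v coeffs X p"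
  by (simp add: endo_matrix_vector endo_apply_def)

text \<open>Column \<open>j\<close> holds the frame components of \<open>S\<close> applied to the
  \<open>j\<close>-th frame field.\<close>

lemma smooth_fun_endo_matrix:
  assumes "smooth_endo_on M UNIV S"
  shows "smooth_fun M (\<lambda>p. endo_matrix S p $ i $ j)"
proof -
  have "endo_matrix S p $ i $ j = coeffs (endo_apply S (\<iota> (axis j 1))) p $ i" for p
    by (simp add: coeffs_endo_apply matrix_vector_mul_component inner_axis)
  then show ?thesis
    using smooth_fun_left_triv[OF smooth_vf_endo_apply[OF assms smooth_frame]] by simp
qed

text \<open>The matrix may depend on the point, so \<open>invariant_endo\<close> also represents
  endomorphism fields that are not invariant; covariant derivatives of sections are of this
  kind.\<close>

lemma smooth_endo_frame:
  assumes "\<And>i j. smooth_fun M (\<lambda>p. A p $ i $ j)"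
  shows "smooth_endo_on M UNIV (\<lambda>p. invariant_endo \<iota> ((*v) (A p)) p)"
  unfolding smooth_endo_on_def Let_def
proof (intro ballI allI)
  fix c v assume c: "c \<in> M"
  let ?w = "\<lambda>x. left_triv \<iota> (param c x) (from_chart M c (param c x) v)"
  have w: "smooth_on (snd c ` fst c) (\<lambda>x. ?w x $ k)" for k
    by (rule smooth_on_left_triv[OF c smooth_on_const])
  have "smooth_on (snd c ` fst c) (\<lambda>x. \<Sum>i\<in>UNIV. (A (param c x) *v ?w x) $ i *\<^sub>R
      field_in_chart M c (\<iota> (axis i 1)) x)"
  proof (intro smooth_on_sum smooth_on_scaleR open_image c)
    show "smooth_on (snd c ` fst c) (\<lambda>x. (A (param c x) *v ?w x) $ i)" for i
      unfolding matrix_vector_mult_def vec_lambda_beta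
      using assms c by (intro smooth_on_sum smooth_on_mult w open_image) (auto simp: smooth_fun_def o_def)
    show "smooth_on (snd c ` fst c) (field_in_chart M c (\<iota> (axis i 1)))" for i
      using smooth_frame c by (simp add: smooth_vf_def)
  qed
  then have "smooth_on (snd c ` fst c) (\<lambda>x. to_chart M c (param c x)
      (blinfun_apply (invariant_endo \<iota> ((*v) (A (param c x))) (param c x)) (from_chart M c (param c x) v)))"
  proof (rule smooth_on_cong[OF _ open_image[OF c]])
    fix x assume x: "x \<in> snd c ` fst c"
    note l = linear_to_chart[OF c param_in[OF x]]
    show "(\<Sum>i\<in>UNIV. (A (param c x) *v ?w x) $ i *\<^sub>R field_in_chart M c (\<iota> (axis i 1)) x) =
      to_chart M c (param c x)
      (blinfun_apply (invariant_endo \<iota> ((*v) (A (param c x))) (param c x)) (from_chart M c (param c x) v))"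
      by (simp add: invariant_endo_apply field_in_chart_def
          frame_expand[of "A (param c x) *v ?w x"] linear_sum[OF l] linear_scale[OF l])
  qed
  then show "smooth_on (snd c ` (fst c \<inter> UNIV)) (\<lambda>x. to_chart M c (param c x)
      (blinfun_apply (invariant_endo \<iota> ((*v) (A (param c x))) (param c x)) (from_chart M c (param c x) v)))"
    by simp
qed

lemma smooth_invariant_endo:
  assumes "linear A"
  shows "smooth_endo_on M UNIV (invariant_endo \<iota> A)"
  using smooth_endo_frame[of "\<lambda>p. matrix A"] assms
  by (simp add: smooth_fun_const matrix_of_matrix_vector_mul matrix_vector_mul)

lemma skew_invariant_endo:
  assumes "linear A" "\<And>x y. h (A x) y = - h x (A y)"
  shows "skew_endo (invariant_form \<iota> h p) (invariant_endo \<iota> A p)"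
  using assms by (simp add: skew_endo_def invariant_form_def left_triv_invariant_endo)

text \<open>An involution \<open>K\<close> anticommuting with \<open>A\<close> exchanges the
  eigenspaces for 1 and -1, and the frame carries them to the tangent space without changing
  dimensions.\<close>

lemma dim_eigenspaces_eq:
  assumes "linear A" "linear K" "inj K" "\<And>x. K (K x) = x" "\<And>x. A (K x) = - K (A x)"
  shows "dim {v. blinfun_apply (invariant_endo \<iota> A p) v = v} =
    dim {v. blinfun_apply (invariant_endo \<iota> A p) v = - v}"
proof -
  have eig: "{v. blinfun_apply (invariant_endo \<iota> A p) v = r *\<^sub>R v} =
      (\<lambda>x. \<iota> x p) ` {x. A x = r *\<^sub>R x}" for r
  proof (intro set_eqI iffI)
    fix v assume "v \<in> {v. blinfun_apply (invariant_endo \<iota> A p) v = r *\<^sub>R v}"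
    then have "A (left_triv \<iota> p v) = r *\<^sub>R left_triv \<iota> p v"
      using left_triv_invariant_endo[OF assms(1), of p v] by (simp add: left_triv_scaleR)
    then show "v \<in> (\<lambda>x. \<iota> x p) ` {x. A x = r *\<^sub>R x}"
      by (intro image_eqI[of _ _ "left_triv \<iota> p v"]) auto
  qed (auto simp: invariant_endo_apply assms frame_scaleR)
  have dim: "dim ((\<lambda>x. \<iota> x p) ` E) = dim E" for E
    by (rule dim_image_eq[OF linear_frame inj_on_subset[OF bij_is_inj[OF bij_frame]]]) simp
  have "{x. A x = - x} = K ` {x. A x = x}"
  proof (intro set_eqI iffI)
    fix x assume "x \<in> {x. A x = - x}"
    then have "A (K x) = K x"
      using assms(5)[of x] by (simp add: linear_neg[OF assms(2)])
    then show "x \<in> K ` {x. A x = x}"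
      using assms(4)[of x] by (intro image_eqI[of _ _ "K x"]) simp_all
  qed (auto simp: assms(5))
  moreover have "dim (K ` {x. A x = x}) = dim {x. A x = x}"
    by (rule dim_image_eq[OF assms(2) inj_on_subset[OF assms(3)]]) simp
  moreover have "dim {v. blinfun_apply (invariant_endo \<iota> A p) v = v} = dim {x. A x = x}"
    using eig[of 1] dim[of "{x. A x = x}"] by (simp only: scaleR_one)
  moreover have "dim {v. blinfun_apply (invariant_endo \<iota> A p) v = - v} = dim {x. A x = - x}"
    using eig[of "-1"] dim[of "{x. A x = - x}"] by (simp only: scaleR_minus1_left)
  ultimately show ?thesis
    by simp
qed

lemma dim_model: "DIM('b) = CARD('n)"
proof -
  have "dim ((\<lambda>x. \<iota> x undefined) ` (UNIV :: (real ^ 'n) set)) = dim (UNIV :: (real ^ 'n) set)"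
    by (rule dim_image_eq[OF linear_frame inj_on_subset[OF bij_is_inj[OF bij_frame]]]) simp
  then show ?thesis
    using bij_is_surj[OF bij_frame[of undefined]] by simp
qed

lemma endo_subbundle_invariant:
  assumes lin: "linear A" "linear B" "linear C"
    and indep: "\<And>a b c. (\<And>x. a *\<^sub>R A x + b *\<^sub>R B x + c *\<^sub>R C x = 0) \<Longrightarrow> a = 0 \<and> b = 0 \<and> c = 0"
  shows "endo_subbundle M 3
    (\<lambda>p. span {invariant_endo \<iota> A p, invariant_endo \<iota> B p, invariant_endo \<iota> C p})"
proof -
  define F where "F = (\<lambda>k :: nat. invariant_endo \<iota> (if k = 0 then A else if k = 1 then B else C))"
  have smooth: "\<forall>k<3. smooth_endo_on M UNIV (F k)"
    using lin by (auto simp: F_def intro: smooth_invariant_endo)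
  have "{k. k < 3} = {0, 1, 2 :: nat}"
    by auto
  then have "{F k q |k. k < 3} = (\<lambda>k. F k q) ` {0, 1, 2}" for q
    by (metis setcompr_eq_image)
  then have F: "{F k q |k. k < 3} = {invariant_endo \<iota> A q, invariant_endo \<iota> B q, invariant_endo \<iota> C q}" for q
    by (simp add: F_def)
  \<comment> \<open>Equal generators would collapse in the set, spoiling both the sum over it and
    its cardinality, so distinctness is settled before independence.\<close>
  have ne: "A \<noteq> B" "A \<noteq> C" "B \<noteq> C"
    using indep[of 1 "-1" 0] indep[of 1 0 "-1"] indep[of 0 1 "-1"] by auto
  have ne': "invariant_endo \<iota> A q \<noteq> invariant_endo \<iota> B q" "invariant_endo \<iota> A q \<noteq> invariant_endo \<iota> C q"
    "invariant_endo \<iota> B q \<noteq> invariant_endo \<iota> C q" for q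
    using ne invariant_endo_inj lin by blast+
  have zero: "a = 0 \<and> b = 0 \<and> c = 0"
    if "a *\<^sub>R invariant_endo \<iota> A q + b *\<^sub>R invariant_endo \<iota> B q + c *\<^sub>R invariant_endo \<iota> C q = 0" for a b c q
  proof (rule indep)
    fix x
    have "blinfun_apply (a *\<^sub>R invariant_endo \<iota> A q + b *\<^sub>R invariant_endo \<iota> B q +
        c *\<^sub>R invariant_endo \<iota> C q) (\<iota> x q) = 0"
      using that by simp
    then have "\<iota> (a *\<^sub>R A x + b *\<^sub>R B x + c *\<^sub>R C x) q = \<iota> 0 q"
      by (simp add: plus_blinfun.rep_eq scaleR_blinfun.rep_eq invariant_endo_apply lin frame_add
          frame_scaleR frame_zero)
    then show "a *\<^sub>R A x + b *\<^sub>R B x + c *\<^sub>R C x = 0"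
      by (simp only: frame_eq_iff)
  qed
  have "independent {invariant_endo \<iota> A q, invariant_endo \<iota> B q, invariant_endo \<iota> C q}" for q
  proof (rule independent_if_scalars_zero)
    fix f v
    assume "(\<Sum>v\<in>{invariant_endo \<iota> A q, invariant_endo \<iota> B q, invariant_endo \<iota> C q}. f v *\<^sub>R v) = 0"
      and "v \<in> {invariant_endo \<iota> A q, invariant_endo \<iota> B q, invariant_endo \<iota> C q}"
    then show "f v = 0"
      using zero[of "f (invariant_endo \<iota> A q)" q "f (invariant_endo \<iota> B q)" "f (invariant_endo \<iota> C q)"] ne'[of q]
      by (auto simp: add.assoc)
  qed simp
  then have "dim (span {invariant_endo \<iota> A q, invariant_endo \<iota> B q, invariant_endo \<iota> C q}) = 3" for q
    using ne'[of q] by (simp add: dim_eq_card_independent)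
  then show ?thesis
    unfolding endo_subbundle_def F[symmetric]
    by (intro allI exI[of _ UNIV] exI[of _ F]) (simp add: smooth)
qed

end

section \<open>Frames of a Lie algebra of fields\<close>

text \<open>The right-hand side of the Koszul formula does not contain the connection. Nondegeneracy
  at \<open>p\<close> can then be applied because every tangent vector at \<open>p\<close> is the
  value of a smooth field.\<close>

lemma levi_civita_unique:
  assumes D: "levi_civita M g D" and D': "levi_civita M g D'"
    and g: "\<And>q. bilinear (g q)" "\<And>q u v. g q u v = g q v u"
    and nondeg: "\<And>u. (\<And>v. g p u v = 0) \<Longrightarrow> u = 0"
    and extend: "\<And>v. \<exists>Z. smooth_vf M Z \<and> Z p = v"
    and XY: "smooth_vf M X" "smooth_vf M Y"
  shows "D X Y p = D' X Y p"
proof -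
  note diff = bilinear_lsub[OF g(1)] bilinear_rsub[OF g(1)] bilinear_ladd[OF g(1)] bilinear_radd[OF g(1)]
  have koszul: "2 * g p (D X Y p) (Z p) =
      vf_apply M X (\<lambda>q. g q (Y q) (Z q)) p + vf_apply M Y (\<lambda>q. g q (Z q) (X q)) p -
      vf_apply M Z (\<lambda>q. g q (X q) (Y q)) p + g p (lie_bracket M X Y p) (Z p) -
      g p (lie_bracket M X Z p) (Y p) - g p (lie_bracket M Y Z p) (X p)"
    if D: "levi_civita M g D" and Z: "smooth_vf M Z" for D Z
  proof -
    have tor: "lie_bracket M U V p = D U V p - D V U p" if "smooth_vf M U" "smooth_vf M V" for U V
      using D that by (simp add: levi_civita_def)
    have met: "vf_apply M U (\<lambda>q. g q (V q) (W q)) p = g p (D U V p) (W p) + g p (V p) (D U W p)"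
      if "smooth_vf M U" "smooth_vf M V" "smooth_vf M W" for U V W
      using D that unfolding levi_civita_def by blast
    show ?thesis
      using g(2)[of p "X p" "D Z Y p"] g(2)[of p "X p" "D Y Z p"] g(2)[of p "Y p" "D X Z p"]
        g(2)[of p "Y p" "D Z X p"] g(2)[of p "Z p" "D Y X p"] g(2)[of p "Z p" "D X Y p"]
      by (simp add: tor met XY Z diff)
  qed
  have "g p (D X Y p - D' X Y p) v = 0" for v
  proof -
    obtain Z where "smooth_vf M Z" "Z p = v"
      using extend by blast
    then show ?thesis
      using koszul[OF D, of Z] koszul[OF D', of Z] by (simp add: diff)
  qed
  then show ?thesis
    using nondeg[of "D X Y p - D' X Y p"] by simp
qed

locale lie_frame = frame M \<iota>
  for M :: "('a::{t2_space,second_countable_topology}, 'b::euclidean_space) atlas"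
    and \<iota> :: "real ^ 'n \<Rightarrow> 'a \<Rightarrow> 'b" +
  fixes br :: "real ^ 'n \<Rightarrow> real ^ 'n \<Rightarrow> real ^ 'n"
  assumes bilinear_br: "bilinear br"
    and bracket_frame: "lie_bracket M (\<iota> x) (\<iota> y) p = \<iota> (br x y) p"
begin

text \<open>Inherited from the bracket of fields, since distinct elements of
  \<open>real ^ 'n\<close> give frame fields that differ at every point.\<close>

lemma br_swap: "br x y = - br y x"
proof -
  have "\<iota> (br x y) p = \<iota> (- br y x) p" for p
    using lie_bracket_swap[of "\<iota> x" "\<iota> y" p] by (simp add: bracket_frame frame_neg)
  then show ?thesis
    by (simp only: frame_eq_iff)
qed

lemma lie_bracket_coeffs_right:
  assumes "smooth_vf M X" "\<And>k. smooth_fun M (\<lambda>p. f p $ k)"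
  shows "lie_bracket M X (\<lambda>p. \<iota> (f p) p) p =
    \<iota> (vec_deriv X f p) p + (\<Sum>k\<in>UNIV. f p $ k *\<^sub>R lie_bracket M X (\<iota> (axis k 1)) p)"
proof -
  have eq: "(\<lambda>p. \<iota> (f p) p) = (\<lambda>p. \<Sum>k\<in>UNIV. f p $ k *\<^sub>R \<iota> (axis k 1) p)"
    by (intro ext frame_expand)
  show ?thesis
    unfolding eq frame_expand[of "vec_deriv X f p"]
    by (simp add: lie_bracket_sum lie_bracket_scaleR smooth_vf_scaleR assms smooth_frame
        sum.distrib vec_deriv_def)
qed

lemma lie_bracket_frame_right:
  assumes "smooth_vf M X"
  shows "lie_bracket M X (\<iota> y) p = \<iota> (br (coeffs X p) y - vec_deriv (\<iota> y) (coeffs X) p) p"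
proof -
  have l: "linear (\<lambda>x. br y x)"
    using bilinear_br by (simp add: bilinear_def)
  have "lie_bracket M (\<iota> y) (\<lambda>p. \<iota> (coeffs X p) p) p =
      \<iota> (vec_deriv (\<iota> y) (coeffs X) p) p + \<iota> (br y (coeffs X p)) p"
    by (subst lie_bracket_coeffs_right)
      (simp_all add: smooth_frame smooth_fun_left_triv assms bracket_frame frame_sum frame_scaleR
        linear_expand[OF l, of "coeffs X p"])
  then show ?thesis
    using lie_bracket_swap[of X "\<iota> y" p] br_swap[of y "coeffs X p"]
    by (simp add: frame_diff frame_neg)
qed

text \<open>The Leibniz rule is used once per argument: first to expand \<open>Y\<close> in the
  frame, then, through antisymmetry in \<open>lie_bracket_frame_right\<close>, to expand
  \<open>X\<close>.\<close>

lemma lie_bracket_coeffs: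
  assumes X: "smooth_vf M X" and Y: "smooth_vf M Y"
  shows "lie_bracket M X Y p = \<iota> (vec_deriv X (coeffs Y) p - vec_deriv Y (coeffs X) p +
    br (coeffs X p) (coeffs Y p)) p"
proof -
  have l: "linear (\<lambda>y. br (coeffs X p) y)"
    using bilinear_br by (simp add: bilinear_def)
  have d: "linear (\<lambda>y. vec_deriv (\<iota> y) (coeffs X) p)"
    using linear_compose[OF linear_frame[of p] vec_deriv_field_linear[OF smooth_fun_left_triv[OF X]]]
      vec_deriv_at[of "\<iota> _" "coeffs X" p]
    by (simp add: o_def)
  have Y': "vec_deriv Y (coeffs X) p = vec_deriv (\<iota> (coeffs Y p)) (coeffs X) p"
    using vec_deriv_at[of Y "coeffs X" p] vec_deriv_at[of "\<iota> (coeffs Y p)" "coeffs X" p] by simp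
  have "lie_bracket M X Y p = lie_bracket M X (\<lambda>p. \<iota> (coeffs Y p) p) p"
    by simp
  also have "\<dots> = \<iota> (vec_deriv X (coeffs Y) p) p + \<iota> (br (coeffs X p) (coeffs Y p)) p -
      \<iota> (vec_deriv Y (coeffs X) p) p"
    unfolding Y' linear_expand[OF l, of "coeffs Y p"] linear_expand[OF d, of "coeffs Y p"]
    by (subst lie_bracket_coeffs_right)
      (simp_all add: X Y smooth_fun_left_triv lie_bracket_frame_right frame_sum frame_scaleR
        frame_diff scaleR_diff_right sum_subtractf)
  finally show ?thesis
    by (simp add: frame_add frame_diff)
qed

text \<open>The frame matrix of \<open>A\<close> is constant, so \<open>A\<close> commutes with
  \<open>vec_deriv\<close>. The derivative terms of the four brackets then cancel in pairs, and only
  the algebraic expression \<open>N\<close> survives.\<close>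

lemma integrable_invariant_endo:
  assumes A: "linear A"
    and N: "\<And>x y. - A (A (br x y)) + A (br (A x) y) + A (br x (A y)) - br (A x) (A y) = 0"
  shows "integrable_endo M (invariant_endo \<iota> A)"
  unfolding integrable_endo_def
proof (intro allI impI)
  fix X Y p assume X: "smooth_vf M X" and Y: "smooth_vf M Y"
  let ?J = "invariant_endo \<iota> A"
  have J: "smooth_vf M (endo_apply ?J Z)" if "smooth_vf M Z" for Z
    by (rule smooth_vf_endo_apply[OF smooth_invariant_endo[OF A] that])
  have cJ: "coeffs (endo_apply ?J Z) q = A (coeffs Z q)" for Z q
    by (simp add: endo_apply_def left_triv_invariant_endo[OF A])
  have dA: "vec_deriv Z (\<lambda>p. A (coeffs W p)) p = A (vec_deriv Z (coeffs W) p)"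
    if W: "smooth_vf M W" for Z W
    using vec_deriv_matrix_vector[of "\<lambda>p. matrix A" "coeffs W" Z p]
    by (simp add: smooth_fun_const smooth_fun_left_triv[OF W] matrix_works
        linear_matrix_vector_mul_eq A vf_apply_const zero_vec_def[symmetric])
  have "coeffs (nijenhuis M ?J X Y) p = 0"
    using N[of "coeffs X p" "coeffs Y p"]
    by (simp add: nijenhuis_def endo_apply_def[of ?J "endo_apply ?J (lie_bracket M X Y)"]
        endo_apply_def[of ?J "lie_bracket M _ _"] left_triv_add left_triv_neg left_triv_diff
        left_triv_invariant_endo[OF A] lie_bracket_coeffs X Y J cJ dA
        linear_add[OF A] linear_diff[OF A] linear_neg[OF A] algebra_simps)
  then show "nijenhuis M ?J X Y p = 0"
    using left_triv_eq_iff[of p "nijenhuis M ?J X Y p" 0] by (simp add: left_triv_zero)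
qed

end


section \<open>Invariant metrics and their Levi-Civita connection\<close>

text \<open>The product \<open>\<Gamma>\<close> is a parameter, pinned down by vanishing torsion and
  skewness for \<open>h\<close>; an explicit formula appears only for the Iwasawa algebra.\<close>

locale metric_frame = lie_frame M \<iota> br
  for M :: "('a::{t2_space,second_countable_topology}, 'b::euclidean_space) atlas"
    and \<iota> :: "real ^ 'n \<Rightarrow> 'a \<Rightarrow> 'b"
    and br :: "real ^ 'n \<Rightarrow> real ^ 'n \<Rightarrow> real ^ 'n" +
  fixes h :: "real ^ 'n \<Rightarrow> real ^ 'n \<Rightarrow> real" and \<Gamma> :: "real ^ 'n \<Rightarrow> real ^ 'n \<Rightarrow> real ^ 'n"
  assumes bilinear_h: "bilinear h" and sym_h: "h x y = h y x"
    and nondeg_h: "(\<And>y. h x y = 0) \<Longrightarrow> x = 0"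
    and bilinear_\<Gamma>: "bilinear \<Gamma>" and torsion_\<Gamma>: "\<Gamma> x y - \<Gamma> y x = br x y"
    and metric_\<Gamma>: "h (\<Gamma> x y) z + h y (\<Gamma> x z) = 0"
begin

abbreviation metric :: "'a \<Rightarrow> 'b \<Rightarrow> 'b \<Rightarrow> real" where
  "metric \<equiv> invariant_form \<iota> h"

definition connection :: "('a \<Rightarrow> 'b) \<Rightarrow> ('a \<Rightarrow> 'b) \<Rightarrow> 'a \<Rightarrow> 'b" where
  "connection X Y p = \<iota> (vec_deriv X (coeffs Y) p + \<Gamma> (coeffs X p) (coeffs Y p)) p"

lemma bilinear_metric: "bilinear (metric p)"
  using linear_left_triv[of p] bilinear_h
  by (auto simp: bilinear_def invariant_form_def intro: linear_compose[unfolded o_def])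

lemma metric_sym: "metric p u v = metric p v u"
  by (simp add: invariant_form_def sym_h)

lemma metric_nondeg:
  assumes "\<And>v. metric p u v = 0"
  shows "u = 0"
proof -
  have "h (left_triv \<iota> p u) y = 0" for y
    using assms[of "\<iota> y p"] by (simp add: invariant_form_def)
  then have "left_triv \<iota> p u = left_triv \<iota> p 0"
    using nondeg_h by (simp add: left_triv_zero)
  then show ?thesis
    by (simp only: left_triv_eq_iff)
qed

lemma pseudo_riemannian_metric: "pseudo_riemannian M metric"
  unfolding pseudo_riemannian_def
proof (intro conjI allI ballI)
  show "bilinear (metric p)" "metric p u v = metric p v u" for p u v
    by (rule bilinear_metric) (rule metric_sym)
  show "(\<forall>v. metric p u v = 0) \<longrightarrow> u = 0" for p u
    using metric_nondeg by blast
  fix c u v assume c: "c \<in> M"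
  let ?w = "\<lambda>u x. left_triv \<iota> (param c x) (from_chart M c (param c x) u)"
  have "smooth_on (snd c ` fst c) (\<lambda>x. \<Sum>i\<in>UNIV. \<Sum>j\<in>UNIV.
      ?w u x $ i * ?w v x $ j * h (axis i 1) (axis j 1))"
    by (intro smooth_on_sum smooth_on_mult smooth_on_const open_image
        smooth_on_left_triv[OF c smooth_on_const] c)
  then show "smooth_on (snd c ` fst c)
      (\<lambda>x. let p = param c x in metric p (from_chart M c p u) (from_chart M c p v))"
    by (simp only: Let_def invariant_form_def real_scaleR_def
        bilinear_expand[OF bilinear_h, of "left_triv \<iota> _ _"])
qed

lemma bilinear_\<Gamma>_component: "bilinear (\<lambda>x y. \<Gamma> x y $ k)"
  using bilinear_\<Gamma> linear_compose[OF _ bounded_linear.linear[OF bounded_linear_vec_nth[of k]]]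
  by (auto simp: bilinear_def o_def)

lemma affine_connection: "affine_connection M connection"
proof -
  have smooth: "smooth_vf M (connection X Y)" if X: "smooth_vf M X" and Y: "smooth_vf M Y" for X Y
    unfolding connection_def[abs_def]
    by (rule smooth_vf_frame)
      (simp add: smooth_fun_add smooth_fun_vec_deriv[OF X smooth_fun_left_triv[OF Y]]
        smooth_fun_bilinear[OF bilinear_\<Gamma>_component] smooth_fun_left_triv X Y)
  have addl: "connection (\<lambda>q. X q + Y q) Z p = connection X Z p + connection Y Z p"
    if "smooth_vf M Z" for X Y Z p
    using linear_add[OF vec_deriv_field_linear[OF smooth_fun_left_triv[OF that]], of "X p" "Y p" p]
      vec_deriv_at[of "\<lambda>q. X q + Y q" "coeffs Z" p]
      vec_deriv_at[of X "coeffs Z" p] vec_deriv_at[of Y "coeffs Z" p]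
    by (simp add: connection_def left_triv_add bilinear_ladd[OF bilinear_\<Gamma>] frame_add)
  have scalel: "connection (\<lambda>q. f q *\<^sub>R X q) Z p = f p *\<^sub>R connection X Z p"
    if "smooth_vf M Z" for f X Z p
    using linear_scale[OF vec_deriv_field_linear[OF smooth_fun_left_triv[OF that]], of "f p" "X p" p]
      vec_deriv_at[of "\<lambda>q. f q *\<^sub>R X q" "coeffs Z" p] vec_deriv_at[of X "coeffs Z" p]
    by (simp add: connection_def left_triv_scaleR bilinear_lmul[OF bilinear_\<Gamma>] frame_add frame_scaleR
        scaleR_add_right)
  have addr: "connection X (\<lambda>q. Y q + Z q) p = connection X Y p + connection X Z p"
    if Y: "smooth_vf M Y" and Z: "smooth_vf M Z" for X Y Z p
    by (simp add: connection_def left_triv_add vec_deriv_add smooth_fun_left_triv Y Z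
        bilinear_radd[OF bilinear_\<Gamma>] frame_add)
  have scaler: "connection X (\<lambda>q. f q *\<^sub>R Y q) p =
      vf_apply M X f p *\<^sub>R Y p + f p *\<^sub>R connection X Y p"
    if f: "smooth_fun M f" and Y: "smooth_vf M Y" for X Y f p
    by (simp add: connection_def left_triv_scaleR vec_deriv_scaleR[OF f smooth_fun_left_triv[OF Y]]
        bilinear_rmul[OF bilinear_\<Gamma>] frame_add frame_scaleR scaleR_add_right)
  show ?thesis
    unfolding affine_connection_def using smooth addl scalel addr scaler by blast
qed

lemma levi_civita_connection: "levi_civita M metric connection"
proof -
  have "connection X Y p - connection Y X p = lie_bracket M X Y p"
    if "smooth_vf M X" "smooth_vf M Y" for X Y p
    using lie_bracket_coeffs[OF that, of p] torsion_\<Gamma>[of "coeffs X p" "coeffs Y p"]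
    by (simp add: connection_def frame_diff[symmetric] algebra_simps)
  moreover have "vf_apply M X (\<lambda>q. metric q (Y q) (Z q)) p =
      metric p (connection X Y p) (Z p) + metric p (Y p) (connection X Z p)"
    if Y: "smooth_vf M Y" and Z: "smooth_vf M Z" for X Y Z p
    using vf_apply_bilinear[OF bilinear_h smooth_fun_left_triv[OF Y] smooth_fun_left_triv[OF Z], of X p]
      metric_\<Gamma>[of "coeffs X p" "coeffs Y p" "coeffs Z p"]
    by (simp add: invariant_form_def connection_def bilinear_ladd[OF bilinear_h]
        bilinear_radd[OF bilinear_h])
  ultimately show ?thesis
    using affine_connection by (simp add: levi_civita_def)
qed

lemma levi_civita_eq_connection:
  assumes "levi_civita M metric D" "smooth_vf M X" "smooth_vf M Y"
  shows "D X Y p = connection X Y p"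
proof (rule levi_civita_unique[OF assms(1) levi_civita_connection bilinear_metric metric_sym])
  show "u = 0" if "\<And>v. metric p u v = 0" for u
    using that by (rule metric_nondeg)
  \<comment> \<open>The combination of frame fields with the components of \<open>v\<close> at
    \<open>p\<close> as constant coefficients extends \<open>v\<close> globally.\<close>
  show "\<exists>Z. smooth_vf M Z \<and> Z p = v" for v
    using smooth_frame[of "left_triv \<iota> p v"] frame_left_triv by blast
qed (use assms in auto)

text \<open>If \<open>A\<close> is the frame matrix of a section, its covariant derivative has
  matrix X A + [\<Gamma> x, A]. The first term stays in \<open>q\<close> because \<open>q\<close>
  does not vary with the point, the second by \<open>stable\<close>.\<close>

lemma parallel_invariant_subbundle:
  fixes q :: "(real ^ 'n ^ 'n) set"
  assumes D: "levi_civita M metric D" and q: "subspace q"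
    and Q: "\<And>p. Q p = (\<lambda>A. invariant_endo \<iota> ((*v) A) p) ` q"
    and stable: "\<And>x A. A \<in> q \<Longrightarrow> matrix (\<Gamma> x) ** A - A ** matrix (\<Gamma> x) \<in> q"
  shows "parallel_subbundle M D Q"
  unfolding parallel_subbundle_def
proof (intro allI impI)
  fix X S assume X: "smooth_vf M X" and "endo_section M Q S"
  then have S: "smooth_endo_on M UNIV S" "\<And>p. S p \<in> Q p"
    by (auto simp: endo_section_def)
  define A where "A = endo_matrix S"
  have A: "A p \<in> q" and SA: "S p = invariant_endo \<iota> ((*v) (A p)) p" for p
  proof -
    obtain B where B: "B \<in> q" "S p = invariant_endo \<iota> ((*v) B) p"
      using S(2)[of p] Q by auto
    moreover have "A p = B"
      using endo_matrix_eq[of S p B] B by (simp add: A_def)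
    ultimately show "A p \<in> q" "S p = invariant_endo \<iota> ((*v) (A p)) p"
      by auto
  qed
  have smA: "smooth_fun M (\<lambda>p. A p $ i $ j)" for i j
    unfolding A_def by (rule smooth_fun_endo_matrix[OF S(1)])
  define G where "G = (\<lambda>x. matrix (\<Gamma> x))"
  have l: "linear (\<Gamma> x)" for x
    using bilinear_\<Gamma> by (simp add: bilinear_def)
  have G: "G x *v y = \<Gamma> x y" for x y
    by (simp add: G_def matrix_works linear_matrix_vector_mul_eq l)
  define DA where "DA p = (\<chi> i j. vf_apply M X (\<lambda>q. A q $ i $ j) p)" for p
  define R where "R p = DA p + (G (coeffs X p) ** A p - A p ** G (coeffs X p))" for p
  have Rq: "R p \<in> q" for p
    unfolding R_def DA_def G_def
    by (intro subspace_add[OF q] vf_apply_matrix_in_subspace[OF q A smA] stable A)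
  have smG: "smooth_fun M (\<lambda>p. G (coeffs X p) $ i $ j)" for i j
    using smooth_fun_bilinear[OF bilinear_\<Gamma>_component[of i] smooth_fun_left_triv[OF X],
        of "\<lambda>_. axis j 1"]
    by (simp add: G_def matrix_def smooth_fun_const)
  have smR: "smooth_fun M (\<lambda>p. R p $ i $ j)" for i j
  proof -
    have "R p $ i $ j = vf_apply M X (\<lambda>q. A q $ i $ j) p + ((\<Sum>k\<in>UNIV. G (coeffs X p) $ i $ k * A p $ k $ j) +
        (-1) * (\<Sum>k\<in>UNIV. A p $ i $ k * G (coeffs X p) $ k $ j))" for p
      by (simp add: R_def DA_def matrix_matrix_mult_def)
    then show ?thesis
      by (simp only:) (intro smooth_fun_add smooth_fun_vf_apply[OF X smA] smooth_fun_mult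
          smooth_fun_const smooth_fun_sum smA smG)
  qed
  have "endo_section M Q (\<lambda>p. invariant_endo \<iota> ((*v) (R p)) p)"
    using smooth_endo_frame[OF smR] Rq by (auto simp: endo_section_def Q)
  moreover have "endo_apply (\<lambda>p. invariant_endo \<iota> ((*v) (R p)) p) Y p =
      D X (endo_apply S Y) p - endo_apply S (D X Y) p" if Y: "smooth_vf M Y" for Y p
  proof -
    have "coeffs (endo_apply S Y) q = A q *v coeffs Y q" for q
      by (simp add: coeffs_endo_apply A_def)
    then have "coeffs (connection X (endo_apply S Y)) p = DA p *v coeffs Y p +
        A p *v vec_deriv X (coeffs Y) p + G (coeffs X p) *v (A p *v coeffs Y p)"
      by (simp add: connection_def vec_deriv_matrix_vector smA smooth_fun_left_triv Y DA_def G)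
    moreover have "coeffs (endo_apply S (connection X Y)) p =
        A p *v (vec_deriv X (coeffs Y) p + G (coeffs X p) *v coeffs Y p)"
      by (simp add: coeffs_endo_apply A_def connection_def G)
    ultimately have "coeffs (connection X (endo_apply S Y)) p - coeffs (endo_apply S (connection X Y)) p =
        R p *v coeffs Y p"
      by (simp add: R_def matrix_vector_mul_assoc matrix_vector_mult_add_rdistrib
          matrix_vector_mult_diff_rdistrib matrix_vector_right_distrib)
    then have "left_triv \<iota> p (connection X (endo_apply S Y) p - endo_apply S (connection X Y) p) =
        left_triv \<iota> p (endo_apply (\<lambda>p. invariant_endo \<iota> ((*v) (R p)) p) Y p)"
      by (simp add: left_triv_diff endo_apply_def left_triv_invariant_endo)
    then have "connection X (endo_apply S Y) p - endo_apply S (connection X Y) p =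
        endo_apply (\<lambda>p. invariant_endo \<iota> ((*v) (R p)) p) Y p"
      by (simp only: left_triv_eq_iff)
    \<comment> \<open>An arbitrary Levi-Civita connection is identified on smooth fields only, so
      the second instance requires smoothness of \<open>endo_apply S Y\<close>.\<close>
    then show ?thesis
      using levi_civita_eq_connection[OF D X Y]
        levi_civita_eq_connection[OF D X smooth_vf_endo_apply[OF S(1) Y]]
      by (simp add: endo_apply_def)
  qed
  ultimately show "\<exists>R. endo_section M Q R \<and> (\<forall>Y. smooth_vf M Y \<longrightarrow>
      (\<forall>p. endo_apply R Y p = D X (endo_apply S Y) p - endo_apply S (D X Y) p))"
    by blast
qed

end

section \<open>Left-invariant fields on a Lie group\<close>

lemma param_prod:
  assumes "inj_on (snd c) (fst c)" "inj_on (snd d) (fst d)" "p \<in> fst c" "q \<in> fst d"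
  shows "param (fst c \<times> fst d, map_prod (snd c) (snd d)) (snd c p, snd d q) = (p, q)"
  using inv_into_f_f[OF map_prod_inj_on[OF assms(1,2)], of "(p, q)"] assms(3,4)
  by (simp add: param_def)

locale smooth_group = manifold M
  for M :: "('a::{t2_space,second_countable_topology}, 'b::euclidean_space) atlas" +
  fixes mul :: "'a \<Rightarrow> 'a \<Rightarrow> 'a" and e :: 'a and inver :: "'a \<Rightarrow> 'a"
  assumes lie_group: "lie_group M mul e inver"
begin

sublocale grp: group mul e inver
  using lie_group by (simp add: lie_group_def)

definition mult_dom :: "('a, 'b) chart \<Rightarrow> ('a, 'b) chart \<Rightarrow> ('a, 'b) chart \<Rightarrow> ('b \<times> 'b) set" where
  "mult_dom c d t = {z \<in> (snd c ` fst c) \<times> (snd d ` fst d).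
     mul (param c (fst z)) (param d (snd z)) \<in> fst t}"

definition mult_map :: "('a, 'b) chart \<Rightarrow> ('a, 'b) chart \<Rightarrow> ('a, 'b) chart \<Rightarrow> 'b \<times> 'b \<Rightarrow> 'b" where
  "mult_map c d t z = snd t (mul (param c (fst z)) (param d (snd z)))"

lemma continuous_mul:
  assumes "continuous_on S f" "continuous_on S g"
  shows "continuous_on S (\<lambda>x. mul (f x) (g x))"
proof -
  have "continuous_on UNIV (\<lambda>(p, q). mul p q)"
    using lie_group by (simp add: lie_group_def smooth_map_def)
  from continuous_on_compose2[OF this continuous_on_Pair[OF assms]] show ?thesis
    by simp
qed

lemma open_mult_dom:
  assumes "c \<in> M" "d \<in> M" "t \<in> M"
  shows "open (mult_dom c d t)"
proof -
  have "continuous_on ((snd c ` fst c) \<times> (snd d ` fst d))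
      (\<lambda>z. mul (param c (fst z)) (param d (snd z)))"
    by (intro continuous_mul
        continuous_on_compose2[OF is_chartD(5)[OF is_chart[OF assms(1)]] continuous_on_fst[OF continuous_on_id]]
        continuous_on_compose2[OF is_chartD(5)[OF is_chart[OF assms(2)]] continuous_on_snd[OF continuous_on_id]])
      auto
  from continuous_open_preimage[OF this open_Times[OF open_image[OF assms(1)] open_image[OF assms(2)]]
      open_domain[OF assms(3)]]
  show ?thesis
    by (simp add: mult_dom_def vimage_def Int_def)
qed

lemma smooth_mult_map:
  assumes "c \<in> M" "d \<in> M" "t \<in> M"
  shows "smooth_on (mult_dom c d t) (mult_map c d t)"
proof -
  let ?c = "(fst c \<times> fst d, map_prod (snd c) (snd d))"
  note inj = is_chartD(3)[OF is_chart[OF assms(1)]] is_chartD(3)[OF is_chart[OF assms(2)]]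
  have "?c \<in> prod_atlas M M"
    unfolding prod_atlas_def using assms by blast
  then have smooth: "smooth_on (snd ?c ` (fst ?c \<inter> (\<lambda>(p, q). mul p q) -` fst t))
      (snd t \<circ> (\<lambda>(p, q). mul p q) \<circ> param ?c)"
    using lie_group assms(3) unfolding lie_group_def smooth_map_def by blast
  have "mult_dom c d t \<subseteq> snd ?c ` (fst ?c \<inter> (\<lambda>(p, q). mul p q) -` fst t)"
  proof
    fix z assume "z \<in> mult_dom c d t"
    then obtain p q where "p \<in> fst c" "q \<in> fst d" "z = (snd c p, snd d q)" "mul p q \<in> fst t"
      by (auto simp: mult_dom_def param_chart assms)
    then show "z \<in> snd ?c ` (fst ?c \<inter> (\<lambda>(p, q). mul p q) -` fst t)"
      by (intro image_eqI[of _ _ "(p, q)"]) auto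
  qed
  note smooth' = smooth_on_subset[OF smooth this]
  show ?thesis
    by (rule smooth_on_cong[OF smooth' open_mult_dom[OF assms]])
      (auto simp: mult_dom_def mult_map_def param_chart assms param_prod[OF inj])
qed

text \<open>Left translation is multiplication with its first coordinate frozen, so its derivative
  is a partial derivative of \<open>mult_map\<close>. This form shows how it varies with
  \<open>a\<close>, which the translation by a single \<open>a\<close> does not.\<close>

lemma left_mult_has_derivative:
  assumes "c \<in> M" "d \<in> M" "t \<in> M" "a \<in> fst c" "p \<in> fst d" "mul a p \<in> fst t"
  shows "((snd t \<circ> mul a \<circ> param d) has_derivative
    (\<lambda>v. frechet_derivative (mult_map c d t) (at (snd c a, snd d p)) (0, v))) (at (snd d p))"
proof -
  have "(snd c a, snd d p) \<in> mult_dom c d t"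
    using assms by (auto simp: mult_dom_def param_chart)
  then have D: "(mult_map c d t has_derivative
      frechet_derivative (mult_map c d t) (at (snd c a, snd d p))) (at (snd c a, snd d p))"
    using smooth_mult_map[OF assms(1-3)] by (intro smooth_on_has_derivative)
  have P: "((\<lambda>y. (snd c a, y)) has_derivative (\<lambda>v. (0, v))) (at (snd d p))"
    by (intro has_derivative_Pair has_derivative_const has_derivative_ident)
  have "snd t \<circ> mul a \<circ> param d = mult_map c d t \<circ> (\<lambda>y. (snd c a, y))"
    using assms by (simp add: fun_eq_iff mult_map_def param_chart)
  then show ?thesis
    using diff_chain_at[OF P D] by (simp add: o_def)
qed

lemma differential_has_derivative:
  "((snd (chart_at M (mul a p)) \<circ> mul a \<circ> param (chart_at M p)) has_derivative
    differential M (mul a) p) (at (snd (chart_at M p) p))"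
proof -
  have "(snd (chart_at M (mul a p)) \<circ> mul a \<circ> param (chart_at M p)) differentiable
      (at (snd (chart_at M p) p))"
    using left_mult_has_derivative[OF chart_at(1) chart_at(1) chart_at(1) chart_at(2) chart_at(2)
        chart_at(2), of a p]
    unfolding differentiable_def by blast
  then show ?thesis
    unfolding differential_def frechet_derivative_works .
qed

lemma linear_differential: "linear (differential M (mul a) p)"
  using differential_has_derivative by (rule has_derivative_linear)

text \<open>Chain rule through the chart chosen at the image point. Taking \<open>f\<close> to be a
  translated coordinate map gives functoriality of \<open>differential\<close>; taking a plain
  coordinate map gives its components in any chart.\<close>

lemma frechet_derivative_left_mult:
  assumes "(f \<circ> param (chart_at M (mul a p))) differentiable (at (snd (chart_at M (mul a p)) (mul a p)))"
  shows "frechet_derivative (f \<circ> mul a \<circ> param (chart_at M p)) (at (snd (chart_at M p) p)) v =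
    frechet_derivative (f \<circ> param (chart_at M (mul a p))) (at (snd (chart_at M (mul a p)) (mul a p)))
      (differential M (mul a) p v)"
proof -
  let ?c = "chart_at M p" and ?t = "chart_at M (mul a p)"
  let ?D = "frechet_derivative (f \<circ> param ?t) (at (snd ?t (mul a p)))"
  have "((f \<circ> param ?t) has_derivative ?D) (at ((snd ?t \<circ> mul a \<circ> param ?c) (snd ?c p)))"
    using assms by (simp add: frechet_derivative_works param_chart chart_at)
  note D = diff_chain_at[OF differential_has_derivative this]
  \<comment> \<open>On \<open>W\<close> the translate stays inside the chart \<open>?t\<close>, so
    passing to its coordinates and back changes nothing there.\<close>
  define W where "W = snd ?c ` fst ?c \<inter> (\<lambda>y. mul a (param ?c y)) -` fst ?t"
  have W: "open W"
    unfolding W_def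
    by (intro continuous_open_preimage continuous_mul continuous_on_const
        is_chartD(5)[OF is_chart] open_image open_domain chart_at)
  have "((f \<circ> mul a \<circ> param ?c) has_derivative ?D \<circ> differential M (mul a) p) (at (snd ?c p))"
  proof (rule has_derivative_transform_within_open[OF D W])
    show "snd ?c p \<in> W"
      by (auto simp: W_def param_chart chart_at)
    show "((f \<circ> param ?t) \<circ> (snd ?t \<circ> mul a \<circ> param ?c)) y = (f \<circ> mul a \<circ> param ?c) y"
      if "y \<in> W" for y
      using that by (auto simp: W_def param_chart chart_at)
  qed
  from frechet_derivative_at[OF this] show ?thesis
    by (metis comp_apply)
qed

lemma differential_comp:
  "differential M (mul a) (mul b p) (differential M (mul b) p v) = differential M (mul (mul a b)) p v"
proof -
  let ?t = "chart_at M (mul a (mul b p))"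
  have "(snd ?t \<circ> mul a \<circ> param (chart_at M (mul b p))) differentiable
      (at (snd (chart_at M (mul b p)) (mul b p)))"
    using differential_has_derivative differentiable_def by blast
  from frechet_derivative_left_mult[OF this, of v] show ?thesis
    by (simp add: differential_def o_def grp.assoc)
qed

lemma differential_unit: "differential M (mul e) p v = v"
proof -
  have "mul e = (\<lambda>q. q)"
    by (simp add: fun_eq_iff)
  then show ?thesis
    using trans_deriv_self[OF chart_at, of p v] by (simp add: differential_def trans_deriv_def o_def)
qed

lemma to_chart_differential:
  assumes "t \<in> M" "mul a p \<in> fst t"
  shows "to_chart M t (mul a p) (differential M (mul a) p v) =
    frechet_derivative (snd t \<circ> mul a \<circ> param (chart_at M p)) (at (snd (chart_at M p) p)) v"
proof -
  have "(snd t \<circ> param (chart_at M (mul a p))) differentiable (at (snd (chart_at M (mul a p)) (mul a p)))"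
    using transition_has_derivative[OF chart_at(1) assms(1) chart_at(2) assms(2)]
    by (auto simp: differentiable_def)
  from frechet_derivative_left_mult[OF this, of v] show ?thesis
    by (simp add: to_chart_def)
qed

section \<open>Left-invariant extension of a tangent vector at the unit\<close>

definition invariant_extension :: "'b \<Rightarrow> 'a \<Rightarrow> 'b" where
  "invariant_extension u a = differential M (mul a) e u"

lemma invariant_extension_invariant: "left_invariant_vf M mul (invariant_extension u)"
  using differential_comp[of _ _ e] by (simp add: left_invariant_vf_def invariant_extension_def)

text \<open>The chart components at \<open>a\<close> are the partial derivative of multiplication in
  its second factor at the pair of \<open>a\<close> and the unit. As multiplication is jointly
  smooth, this is smooth in \<open>a\<close>.\<close>

lemma smooth_invariant_extension: "smooth_vf M (invariant_extension u)"
  unfolding smooth_vf_def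
proof
  fix c assume c: "c \<in> M"
  let ?d = "chart_at M e"
  show "smooth_on (snd c ` fst c) (field_in_chart M c (invariant_extension u))"
  proof (rule smooth_on_cong[OF _ open_image[OF c]])
    \<comment> \<open>The chart \<open>c\<close> serves for the first factor and for the product
      alike, because \<open>mul p e = p\<close>.\<close>
    let ?D = "\<lambda>z. frechet_derivative (mult_map c ?d c) (at z) (0, u)"
    have D: "smooth_on (mult_dom c ?d c) ?D"
      by (intro smooth_on_frechet_derivative smooth_mult_map smooth_on_const open_mult_dom c chart_at)
    show "smooth_on (snd c ` fst c) (\<lambda>x. ?D (x, snd ?d e))"
      by (rule smooth_on_compose[OF D smooth_on_Pair[OF smooth_on_id smooth_on_const]
            open_image[OF c] open_mult_dom[OF c chart_at(1) c]])
        (auto simp: open_image c mult_dom_def param_chart chart_at)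
    fix x assume x: "x \<in> snd c ` fst c"
    define p where "p = param c x"
    have p: "p \<in> fst c" "mul p e \<in> fst c" "x = snd c p"
      using x by (auto simp: p_def param_in chart_param)
    have "((snd c \<circ> mul p \<circ> param ?d) has_derivative (\<lambda>v.
        frechet_derivative (mult_map c ?d c) (at (x, snd ?d e)) (0, v))) (at (snd ?d e))"
      using left_mult_has_derivative[OF c chart_at(1) c p(1) chart_at(2) p(2)] p(3) by simp
    from frechet_derivative_at[OF this]
    have "?D (x, snd ?d e) = frechet_derivative (snd c \<circ> mul p \<circ> param ?d) (at (snd ?d e)) u"
      by metis
    also have "\<dots> = to_chart M c (mul p e) (differential M (mul p) e u)"
      using to_chart_differential[OF c p(2)] by simp
    finally show "?D (x, snd ?d e) = field_in_chart M c (invariant_extension u) x"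
      by (simp add: field_in_chart_def invariant_extension_def p_def)
  qed
qed

lemma left_invariant_vf_at:
  assumes "left_invariant_vf M mul X"
  shows "X q = differential M (mul (mul q (inver p))) p (X p)"
proof -
  have "X (mul (mul q (inver p)) p) = differential M (mul (mul q (inver p))) p (X p)"
    using assms by (simp add: left_invariant_vf_def)
  moreover have "mul (mul q (inver p)) p = q"
    by (simp add: grp.assoc)
  ultimately show ?thesis
    by simp
qed

lemma lie_algebra_iso_bij:
  assumes "lie_algebra_iso M mul br \<iota>"
  shows "bij (\<lambda>x. \<iota> x p)"
proof -
  have lin: "linear (\<lambda>x. \<iota> x q)" for q
    using assms by (simp add: lie_algebra_iso_def)
  have inj: "inj \<iota>" and range: "range \<iota> = {X. smooth_vf M X \<and> left_invariant_vf M mul X}"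
    using assms by (auto simp: lie_algebra_iso_def bij_betw_def)
  have "x = 0" if "\<iota> x p = 0" for x
  proof -
    have inv: "left_invariant_vf M mul (\<iota> x)"
      using range by blast
    have "\<iota> x q = \<iota> 0 q" for q
      using left_invariant_vf_at[OF inv, of q p] that linear_0[OF linear_differential]
        linear_0[OF lin] by simp
    then have "\<iota> x = \<iota> 0"
      by (rule ext)
    then show "x = 0"
      using inj by (simp add: inj_eq)
  qed
  then have "inj (\<lambda>x. \<iota> x p)"
    using linear_injective_0[OF lin] by blast
  moreover have "surj (\<lambda>x. \<iota> x p)"
  proof -
    have "\<exists>x. v = \<iota> x p" for v
    proof -
      \<comment> \<open>The vector \<open>v\<close> sits at \<open>p\<close>, so it is first
        translated back to the unit and then extended.\<close>
      define X where "X = invariant_extension (differential M (mul (inver p)) p v)"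
      obtain x where "\<iota> x = X"
        using range smooth_invariant_extension invariant_extension_invariant by (metis (mono_tags, lifting) X_def imageE mem_Collect_eq)
      moreover have "X p = v"
        using differential_comp[of p "inver p" p v] by (simp add: X_def invariant_extension_def differential_unit)
      ultimately show ?thesis
        by metis
    qed
    then show ?thesis
      by (simp add: surj_def)
  qed
  ultimately show ?thesis
    by (simp add: bij_def)
qed

lemma lie_algebra_iso_frame:
  fixes \<iota> :: "real ^ 'n \<Rightarrow> 'a \<Rightarrow> 'b"
  assumes "lie_algebra_iso M mul br \<iota>" "bilinear br"
  shows "lie_frame M \<iota> br"
proof (intro lie_frame.intro frame.intro manifold_axioms frame_axioms.intro lie_frame_axioms.intro)
  have range: "range \<iota> = {X. smooth_vf M X \<and> left_invariant_vf M mul X}"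
    using assms by (auto simp: lie_algebra_iso_def bij_betw_def)
  then show "smooth_vf M (\<iota> x)" for x
    by blast
  show "linear (\<lambda>x. \<iota> x p)" for p
    using assms(1) by (simp add: lie_algebra_iso_def)
  show "lie_bracket M (\<iota> x) (\<iota> y) p = \<iota> (br x y) p" for x y p
    using assms(1) by (simp add: lie_algebra_iso_def)
  show "bij (\<lambda>x. \<iota> x p)" for p
    by (rule lie_algebra_iso_bij[OF assms(1)])
qed (rule assms(2))

end


section \<open>Algebra of the Iwasawa algebra\<close>

lemma iwa_vec_eqI:
  fixes x y :: iwa
  assumes "x $ BV2 = y $ BV2" "x $ BU2 = y $ BU2" "x $ BA = y $ BA" "x $ BB = y $ BB"
    "x $ BV0 = y $ BV0" "x $ BV1 = y $ BV1" "x $ BU0 = y $ BU0" "x $ BU1 = y $ BU1"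
  shows "x = y"
  unfolding vec_eq_iff
proof
  fix i show "x $ i = y $ i"
    using assms by (cases i) simp_all
qed

lemma sum_iwa_index:
  "sum f (UNIV :: iwa_index set) =
    f BV2 + f BU2 + f BA + f BB + f BV0 + f BV1 + f BU0 + f BU1" for f :: "iwa_index \<Rightarrow> real"
  by (simp add: UNIV_iwa_index add.assoc)

lemma iwa_form_expand:
  "iwa_form e1 e2 x y = - e1 * x $ BV2 * y $ BV2 + x $ BU2 * y $ BU2 - e1 * x $ BA * y $ BA
    + x $ BB * y $ BB + e1 * e2 * x $ BV0 * y $ BV0 - e2 * x $ BV1 * y $ BV1
    - e2 * x $ BU0 * y $ BU0 + e1 * e2 * x $ BU1 * y $ BU1"
  by (simp add: iwa_form_def sum_iwa_index eps_of_def)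

lemma axis_component: "axis i r $ j = (if j = i then r else 0)"
  by (simp add: axis_def)

lemma iwa_form_axis: "iwa_form e1 e2 (axis i 1) w = iwa_gram e1 e2 i * w $ i"
  by (cases i) (simp_all add: iwa_form_expand axis_def eps_of_def)

text \<open>Without \<open>sqrt 3\<close> in denominators, all identities are polynomial in it, and
  \<open>sqrt_3_mult\<close> reduces the powers that arise when structures are composed.\<close>

lemma inverse_sqrt_3: "1 / sqrt 3 = sqrt 3 / 3" "1 / (2 * sqrt 3) = sqrt 3 / 6" "2 / sqrt 3 = 2 * sqrt 3 / 3"
  by (simp_all add: field_simps)

lemma sqrt_3_mult: "sqrt 3 * (sqrt 3 * z) = 3 * z"
  by (simp flip: mult.assoc)

lemma iwa_bracket_nth:
  "iwa_bracket x y $ BV2 = alt2 BU2 BV2 x y - alt2 BV0 BU0 x y - alt2 BV1 BU1 x y"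
  "iwa_bracket x y $ BU2 = 0"
  "iwa_bracket x y $ BA = sqrt 3 / 3 * alt2 BB BA x y"
  "iwa_bracket x y $ BB = 0"
  "iwa_bracket x y $ BV0 = alt2 BU2 BV0 x y / 2 - sqrt 3 / 2 * alt2 BB BV0 x y"
  "iwa_bracket x y $ BV1 = alt2 BU2 BV1 x y / 2 - sqrt 3 / 6 * alt2 BB BV1 x y + alt2 BA BV0 x y"
  "iwa_bracket x y $ BU0 = alt2 BU2 BU0 x y / 2 + sqrt 3 / 2 * alt2 BB BU0 x y - alt2 BA BU1 x y"
  "iwa_bracket x y $ BU1 = alt2 BU2 BU1 x y / 2 + sqrt 3 / 6 * alt2 BB BU1 x y - 2 * sqrt 3 / 3 * alt2 BA BV1 x y"
  by (simp_all add: iwa_bracket_def inverse_sqrt_3 axis_def mult.commute)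

locale iwa_signs =
  fixes e1 e2 :: real
  assumes e1: "e1 \<in> {-1, 1}" and e2: "e2 \<in> {-1, 1}"
begin

lemma sign_simps [simp]:
  "e1 * e1 = 1" "e1 * (e1 * z) = z" "e2 * e2 = 1" "e2 * (e2 * z) = z"
  using e1 e2 by auto

text \<open>This and the next three tables absorb the Gram signs into the coefficients of the
  wedges, so that later computations never unfold \<open>wedge\<close>.\<close>

lemma J1_nth:
  "J1 e1 e2 w $ BV2 = - e2 * w $ BU2"
  "J1 e1 e2 w $ BU2 = - e1 * e2 * w $ BV2"
  "J1 e1 e2 w $ BA = w $ BB"
  "J1 e1 e2 w $ BB = e1 * w $ BA"
  "J1 e1 e2 w $ BV0 = w $ BU0 / 2 - e1 * sqrt 3 * w $ BV1 / 2"
  "J1 e1 e2 w $ BV1 = e1 * w $ BU1 / 2 - sqrt 3 * w $ BV0 / 2"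
  "J1 e1 e2 w $ BU0 = sqrt 3 * w $ BU1 / 2 + e1 * w $ BV0 / 2"
  "J1 e1 e2 w $ BU1 = e1 * sqrt 3 * w $ BU0 / 2 + w $ BV1 / 2"
  by (simp_all add: J1_def Let_def wedge_def iwa_form_axis axis_component eps_of_def algebra_simps)

lemma J2_nth:
  "J2 e1 e2 w $ BV2 = - e1 * sqrt 3 * w $ BU1 / 2 + w $ BV0 / 2"
  "J2 e1 e2 w $ BU2 = - e2 * w $ BU0 / 2 - e1 * e2 * sqrt 3 * w $ BV1 / 2"
  "J2 e1 e2 w $ BA = e1 * e2 * w $ BU1 / 2 + e2 * sqrt 3 * w $ BV0 / 2"
  "J2 e1 e2 w $ BB = - e2 * sqrt 3 * w $ BU0 / 2 + e1 * e2 * w $ BV1 / 2"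
  "J2 e1 e2 w $ BV0 = e2 * w $ BV2 / 2 + sqrt 3 * w $ BA / 2"
  "J2 e1 e2 w $ BV1 = - e1 * sqrt 3 * w $ BU2 / 2 + e1 * w $ BB / 2"
  "J2 e1 e2 w $ BU0 = - w $ BU2 / 2 - sqrt 3 * w $ BB / 2"
  "J2 e1 e2 w $ BU1 = - e1 * e2 * sqrt 3 * w $ BV2 / 2 + e1 * w $ BA / 2"
  by (simp_all add: J2_def Let_def wedge_def iwa_form_axis axis_component eps_of_def algebra_simps)

lemma J3_nth:
  "J3 e1 e2 w $ BV2 = w $ BU0 / 2 + e1 * sqrt 3 * w $ BV1 / 2"
  "J3 e1 e2 w $ BU2 = e2 * sqrt 3 * w $ BU1 / 2 - e1 * e2 * w $ BV0 / 2"
  "J3 e1 e2 w $ BA = - e2 * sqrt 3 * w $ BU0 / 2 + e1 * e2 * w $ BV1 / 2"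
  "J3 e1 e2 w $ BB = e2 * w $ BU1 / 2 + e1 * e2 * sqrt 3 * w $ BV0 / 2"
  "J3 e1 e2 w $ BV0 = w $ BU2 / 2 - sqrt 3 * w $ BB / 2"
  "J3 e1 e2 w $ BV1 = - e2 * sqrt 3 * w $ BV2 / 2 - w $ BA / 2"
  "J3 e1 e2 w $ BU0 = - e1 * e2 * w $ BV2 / 2 + e1 * sqrt 3 * w $ BA / 2"
  "J3 e1 e2 w $ BU1 = - e1 * sqrt 3 * w $ BU2 / 2 - e1 * w $ BB / 2"
  by (simp_all add: J3_def Let_def wedge_def iwa_form_axis axis_component eps_of_def algebra_simps)

lemma J1_tilde_nth:
  "J1_tilde e1 e2 w $ BV2 = e2 * w $ BU2"
  "J1_tilde e1 e2 w $ BU2 = e1 * e2 * w $ BV2"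
  "J1_tilde e1 e2 w $ BA = w $ BB"
  "J1_tilde e1 e2 w $ BB = e1 * w $ BA"
  "J1_tilde e1 e2 w $ BV0 = w $ BU0 / 2 - e1 * sqrt 3 * w $ BV1 / 2"
  "J1_tilde e1 e2 w $ BV1 = e1 * w $ BU1 / 2 - sqrt 3 * w $ BV0 / 2"
  "J1_tilde e1 e2 w $ BU0 = sqrt 3 * w $ BU1 / 2 + e1 * w $ BV0 / 2"
  "J1_tilde e1 e2 w $ BU1 = e1 * sqrt 3 * w $ BU0 / 2 + w $ BV1 / 2"
  by (simp_all add: J1_tilde_def Let_def wedge_def iwa_form_axis axis_component eps_of_def algebra_simps)

text \<open>The Levi-Civita product, read off from the Koszul formula
  \<open>2 \<langle>\<Gamma> x y, z\<rangle> = \<langle>[x, y], z\<rangle> - \<langle>[y, z], x\<rangle> + \<langle>[z, x], y\<rangle>\<close>.\<close>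

definition iwa_connection :: "iwa \<Rightarrow> iwa \<Rightarrow> iwa" where
  "iwa_connection x y = (\<chi> k. case k of
      BV2 \<Rightarrow> - x $ BV2 * y $ BU2 - x $ BV0 * y $ BU0 / 2 - x $ BV1 * y $ BU1 / 2
          + x $ BU0 * y $ BV0 / 2 + x $ BU1 * y $ BV1 / 2
    | BU2 \<Rightarrow> - e1 * x $ BV2 * y $ BV2 + e1 * e2 * x $ BV0 * y $ BV0 / 2
          - e2 * x $ BV1 * y $ BV1 / 2 - e2 * x $ BU0 * y $ BU0 / 2
          + e1 * e2 * x $ BU1 * y $ BU1 / 2
    | BA \<Rightarrow> - sqrt 3 * x $ BA * y $ BB / 3 + e1 * e2 * x $ BV0 * y $ BV1 / 2
          + e1 * e2 * x $ BV1 * y $ BV0 / 2 + e2 * sqrt 3 * x $ BV1 * y $ BU1 / 3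
          - e1 * e2 * x $ BU0 * y $ BU1 / 2 + e2 * sqrt 3 * x $ BU1 * y $ BV1 / 3
          - e1 * e2 * x $ BU1 * y $ BU0 / 2
    | BB \<Rightarrow> - e1 * sqrt 3 * x $ BA * y $ BA / 3
          - e1 * e2 * sqrt 3 * x $ BV0 * y $ BV0 / 2 + e2 * sqrt 3 * x $ BV1 * y $ BV1 / 6
          - e2 * sqrt 3 * x $ BU0 * y $ BU0 / 2 + e1 * e2 * sqrt 3 * x $ BU1 * y $ BU1 / 6
    | BV0 \<Rightarrow> e2 * x $ BV2 * y $ BU0 / 2 + e1 * x $ BA * y $ BV1 / 2
          - x $ BV0 * y $ BU2 / 2 + sqrt 3 * x $ BV0 * y $ BB / 2 + e1 * x $ BV1 * y $ BA / 2
          + e2 * x $ BU0 * y $ BV2 / 2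
    | BV1 \<Rightarrow> - e1 * e2 * x $ BV2 * y $ BU1 / 2 + x $ BA * y $ BV0 / 2
          - e1 * sqrt 3 * x $ BA * y $ BU1 / 3 - x $ BV0 * y $ BA / 2 - x $ BV1 * y $ BU2 / 2
          + sqrt 3 * x $ BV1 * y $ BB / 6 - e1 * e2 * x $ BU1 * y $ BV2 / 2
          - e1 * sqrt 3 * x $ BU1 * y $ BA / 3
    | BU0 \<Rightarrow> e1 * e2 * x $ BV2 * y $ BV0 / 2 - x $ BA * y $ BU1 / 2
          + e1 * e2 * x $ BV0 * y $ BV2 / 2 - x $ BU0 * y $ BU2 / 2
          - sqrt 3 * x $ BU0 * y $ BB / 2 + x $ BU1 * y $ BA / 2
    | BU1 \<Rightarrow> - e2 * x $ BV2 * y $ BV1 / 2 - sqrt 3 * x $ BA * y $ BV1 / 3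
          - e1 * x $ BA * y $ BU0 / 2 - e2 * x $ BV1 * y $ BV2 / 2 + sqrt 3 * x $ BV1 * y $ BA / 3
          - e1 * x $ BU0 * y $ BA / 2 - x $ BU1 * y $ BU2 / 2 - sqrt 3 * x $ BU1 * y $ BB / 6)"

lemmas iwa_nth = J1_nth J2_nth J3_nth J1_tilde_nth iwa_bracket_nth alt2_def

text \<open>Together with \<open>iwa_connection_metric\<close> this certifies the explicit table:
  the two identities characterise the Levi-Civita product.\<close>

lemma iwa_connection_torsion: "iwa_connection x y - iwa_connection y x = iwa_bracket x y"
  by (intro iwa_vec_eqI; simp add: iwa_connection_def iwa_nth field_simps)

lemma iwa_connection_metric:
  "iwa_form e1 e2 (iwa_connection x y) z + iwa_form e1 e2 y (iwa_connection x z) = 0"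
  by (simp add: iwa_form_expand iwa_connection_def field_simps)

lemma bilinear_iwa_connection: "bilinear iwa_connection"
  unfolding bilinear_def
  by (intro conjI allI linearI; intro iwa_vec_eqI; simp add: iwa_connection_def field_simps)

section \<open>Quaternionic relations, covariant derivatives and integrability\<close>

lemma linear_J: "linear (J1 e1 e2)" "linear (J2 e1 e2)" "linear (J3 e1 e2)" "linear (J1_tilde e1 e2)"
  by (intro linearI; intro iwa_vec_eqI; simp add: iwa_nth field_simps)+

lemma J_square:
  "J1 e1 e2 (J1 e1 e2 x) = e1 *\<^sub>R x" "J2 e1 e2 (J2 e1 e2 x) = e2 *\<^sub>R x"
  "J3 e1 e2 (J3 e1 e2 x) = (- e1 * e2) *\<^sub>R x" "J1_tilde e1 e2 (J1_tilde e1 e2 x) = e1 *\<^sub>R x"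
  by (intro iwa_vec_eqI; simp add: iwa_nth field_simps sqrt_3_mult)+

lemma J_mult:
  "J1 e1 e2 (J2 e1 e2 x) = J3 e1 e2 x" "J2 e1 e2 (J1 e1 e2 x) = - J3 e1 e2 x"
  "J2 e1 e2 (J3 e1 e2 x) = - e2 *\<^sub>R J1 e1 e2 x" "J3 e1 e2 (J2 e1 e2 x) = e2 *\<^sub>R J1 e1 e2 x"
  "J3 e1 e2 (J1 e1 e2 x) = - e1 *\<^sub>R J2 e1 e2 x" "J1 e1 e2 (J3 e1 e2 x) = e1 *\<^sub>R J2 e1 e2 x"
  by (intro iwa_vec_eqI; simp add: iwa_nth field_simps sqrt_3_mult)+

lemma J_skew:
  "iwa_form e1 e2 (J1 e1 e2 x) y = - iwa_form e1 e2 x (J1 e1 e2 y)"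
  "iwa_form e1 e2 (J2 e1 e2 x) y = - iwa_form e1 e2 x (J2 e1 e2 y)"
  "iwa_form e1 e2 (J3 e1 e2 x) y = - iwa_form e1 e2 x (J3 e1 e2 y)"
  "iwa_form e1 e2 (J1_tilde e1 e2 x) y = - iwa_form e1 e2 x (J1_tilde e1 e2 y)"
  by (simp add: iwa_form_expand iwa_nth field_simps)+

lemma J_independent:
  assumes "\<And>x. a *\<^sub>R J1 e1 e2 x + b *\<^sub>R J2 e1 e2 x + c *\<^sub>R J3 e1 e2 x = 0"
  shows "a = 0 \<and> b = 0 \<and> c = 0"
proof -
  \<comment> \<open>On \<open>eV2\<close> the coordinates \<open>BU2\<close>, \<open>BV0\<close> and
    \<open>BU0\<close> are each reached by exactly one of the three structures, so they isolate
    \<open>a\<close>, \<open>b\<close> and \<open>c\<close>.\<close>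
  have "(a *\<^sub>R J1 e1 e2 eV2 + b *\<^sub>R J2 e1 e2 eV2 + c *\<^sub>R J3 e1 e2 eV2) $ k = 0" for k
    by (simp add: assms)
  from this[of BU2] this[of BV0] this[of BU0]
  have "a * (e1 * e2) = 0" "b * e2 = 0" "c * (e1 * e2) = 0"
    by (simp_all add: iwa_nth axis_def)
  moreover have "e1 \<noteq> 0" "e2 \<noteq> 0"
    using e1 e2 by auto
  ultimately show ?thesis
    by simp
qed

text \<open>The coefficients, linear in \<open>x\<close>, are the connection forms of
  \<open>Q\<close>. No structure occurs in its own derivative, as its square is constant and it
  anticommutes with the other two. The third formula agrees with the product rule for J3 = J1
  J2.\<close>

lemma J_connection:
  "iwa_connection x (J1 e1 e2 y) - J1 e1 e2 (iwa_connection x y) =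
    (e1 * x $ BV0 / 2 - sqrt 3 * x $ BU1 / 2) *\<^sub>R J2 e1 e2 y
    - (e1 * sqrt 3 * x $ BV1 / 2 + x $ BU0 / 2) *\<^sub>R J3 e1 e2 y"
  "iwa_connection x (J2 e1 e2 y) - J2 e1 e2 (iwa_connection x y) =
    (e1 * e2 * sqrt 3 * x $ BU1 / 2 - e2 * x $ BV0 / 2) *\<^sub>R J1 e1 e2 y
    + (e2 * x $ BV2 / 2 - sqrt 3 * x $ BA / 2) *\<^sub>R J3 e1 e2 y"
  "iwa_connection x (J3 e1 e2 y) - J3 e1 e2 (iwa_connection x y) =
    (- e2 * x $ BU0 / 2 - e1 * e2 * sqrt 3 * x $ BV1 / 2) *\<^sub>R J1 e1 e2 y
    + (e1 * e2 * x $ BV2 / 2 - e1 * sqrt 3 * x $ BA / 2) *\<^sub>R J2 e1 e2 y"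
  by (intro iwa_vec_eqI; simp add: iwa_nth iwa_connection_def field_simps sqrt_3_mult)+

text \<open>Replacing the doubled application by the factor \<open>e1\<close> first keeps the
  expansion short; what remains are eight bilinear identities in the coordinates.\<close>

lemma J_integrable:
  assumes "A = J1 e1 e2 \<or> A = J1_tilde e1 e2"
  shows "- A (A (iwa_bracket x y)) + A (iwa_bracket (A x) y) + A (iwa_bracket x (A y))
    - iwa_bracket (A x) (A y) = 0"
  using assms
  by (elim disjE; simp only: J_square; intro iwa_vec_eqI;
      simp add: iwa_nth field_simps sqrt_3_mult)

text \<open>\<open>J\<^sub>1\<close> only pairs basis vectors with opposite eigenvalues of this involution.\<close>

definition grading :: "iwa \<Rightarrow> iwa" where
  "grading x = (\<chi> k. if k \<in> {BU2, BB, BU1, BV0} then x $ k else - x $ k)"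

lemma linear_grading: "linear grading"
  by (rule linearI) (simp_all add: grading_def vec_eq_iff)

lemma grading_grading: "grading (grading x) = x"
  by (simp add: grading_def vec_eq_iff)

lemma J_grading:
  "J1 e1 e2 (grading x) = - grading (J1 e1 e2 x)"
  "J1_tilde e1 e2 (grading x) = - grading (J1_tilde e1 e2 x)"
  by (intro iwa_vec_eqI; simp add: iwa_nth grading_def)+

end

lemma bilinear_iwa_bracket: "bilinear iwa_bracket"
  unfolding bilinear_def
  by (intro conjI allI linearI; intro iwa_vec_eqI; simp add: iwa_bracket_nth alt2_def field_simps)

lemma bilinear_iwa_form: "bilinear (iwa_form e1 e2)"
  unfolding bilinear_def
  by (intro conjI allI linearI; simp add: iwa_form_expand field_simps)

lemma iwa_form_sym: "iwa_form e1 e2 x y = iwa_form e1 e2 y x"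
  by (simp add: iwa_form_expand algebra_simps)

lemma (in iwa_signs) iwa_form_nondeg:
  assumes "\<And>y. iwa_form e1 e2 x y = 0"
  shows "x = 0"
proof -
  have "iwa_gram e1 e2 i * x $ i = 0" for i
    using assms[of "axis i 1"] by (simp add: iwa_form_sym[of e1 e2 x] iwa_form_axis)
  moreover have "iwa_gram e1 e2 i \<noteq> 0" for i
    using e1 e2 by (cases i) (auto simp: eps_of_def)
  ultimately show ?thesis
    by (simp add: vec_eq_iff)
qed

section \<open>The invariant structure on the group\<close>

locale iwa_group = smooth_group M mul e inver + iwa_signs e1 e2
  for M :: "('a::{t2_space,second_countable_topology}, 'b::euclidean_space) atlas"
    and mul :: "'a \<Rightarrow> 'a \<Rightarrow> 'a" and e :: 'a and inver :: "'a \<Rightarrow> 'a"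
    and e1 e2 :: real +
  fixes \<iota> :: "iwa \<Rightarrow> 'a \<Rightarrow> 'b"
  assumes iso: "lie_algebra_iso M mul iwa_bracket \<iota>"
begin

sublocale metric_frame M \<iota> iwa_bracket "iwa_form e1 e2" iwa_connection
  by (intro metric_frame.intro metric_frame_axioms.intro lie_algebra_iso_frame iso
      bilinear_iwa_bracket bilinear_iwa_form iwa_form_sym iwa_form_nondeg bilinear_iwa_connection
      iwa_connection_torsion iwa_connection_metric)

abbreviation I1 :: "'a \<Rightarrow> 'b \<Rightarrow>\<^sub>L 'b" where "I1 \<equiv> invariant_endo \<iota> (J1 e1 e2)"
abbreviation I2 :: "'a \<Rightarrow> 'b \<Rightarrow>\<^sub>L 'b" where "I2 \<equiv> invariant_endo \<iota> (J2 e1 e2)"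
abbreviation I3 :: "'a \<Rightarrow> 'b \<Rightarrow>\<^sub>L 'b" where "I3 \<equiv> invariant_endo \<iota> (J3 e1 e2)"

text \<open>The fibre of \<open>Q\<close> in frame components, the same at every point.\<close>

definition quat_matrices :: "(real ^ iwa_index ^ iwa_index) set" where
  "quat_matrices = span {matrix (J1 e1 e2), matrix (J2 e1 e2), matrix (J3 e1 e2)}"

lemma J_matrix:
  "(*v) (matrix (J1 e1 e2)) = J1 e1 e2" "(*v) (matrix (J2 e1 e2)) = J2 e1 e2"
  "(*v) (matrix (J3 e1 e2)) = J3 e1 e2"
  by (simp_all add: linear_matrix_vector_mul_eq linear_J)

lemma quat_bundle_eq:
  "span {I1 p, I2 p, I3 p} = (\<lambda>A. invariant_endo \<iota> ((*v) A) p) ` quat_matrices"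
  using linear_span_image[OF linear_invariant_endo_matrix[of p],
      of "{matrix (J1 e1 e2), matrix (J2 e1 e2), matrix (J3 e1 e2)}"]
  by (simp add: quat_matrices_def J_matrix)

text \<open>Commutation with a fixed matrix is linear, so the three generators suffice, and for them
  \<open>J_connection\<close> gives the result.\<close>

lemma quat_matrices_stable:
  assumes "A \<in> quat_matrices"
  shows "matrix (iwa_connection x) ** A - A ** matrix (iwa_connection x) \<in> quat_matrices"
proof -
  let ?G = "matrix (iwa_connection x)"
  let ?S = "{matrix (J1 e1 e2), matrix (J2 e1 e2), matrix (J3 e1 e2)}"
  have G: "?G *v y = iwa_connection x y" for y
    using bilinear_iwa_connection by (simp add: bilinear_def linear_matrix_vector_mul_eq)
  have comm: "?G ** B - B ** ?G = C"
    if "\<And>y. iwa_connection x (B *v y) - B *v iwa_connection x y = C *v y" for B C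
    unfolding matrix_eq
    using that by (simp add: matrix_vector_mult_diff_rdistrib G flip: matrix_vector_mul_assoc)
  have in_q: "a *\<^sub>R matrix (J1 e1 e2) + b *\<^sub>R matrix (J2 e1 e2) + c *\<^sub>R matrix (J3 e1 e2) \<in> span ?S"
    for a b c
    by (intro span_add span_scale span_base) auto
  \<comment> \<open>Padding each formula of \<open>J_connection\<close> with a zero coefficient
    brings all three generators into one shape.\<close>
  have combine: "?G ** B - B ** ?G \<in> span ?S"
    if "\<And>y. iwa_connection x (B *v y) - B *v iwa_connection x y =
      a *\<^sub>R J1 e1 e2 y + b *\<^sub>R J2 e1 e2 y + c *\<^sub>R J3 e1 e2 y" for B a b c
  proof -
    have "?G ** B - B ** ?G =
        a *\<^sub>R matrix (J1 e1 e2) + b *\<^sub>R matrix (J2 e1 e2) + c *\<^sub>R matrix (J3 e1 e2)"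
      by (rule comm) (simp add: that matrix_vector_mult_add_rdistrib J_matrix
          flip: scaleR_matrix_vector_assoc)
    then show ?thesis
      using in_q by simp
  qed
  have gen: "?G ** B - B ** ?G \<in> span ?S" if "B \<in> ?S" for B
    using that
  proof (elim insertE emptyE)
    assume "B = matrix (J1 e1 e2)"
    then show ?thesis
      by (intro combine[of B 0 "e1 * x $ BV0 / 2 - sqrt 3 * x $ BU1 / 2"
            "- (e1 * sqrt 3 * x $ BV1 / 2 + x $ BU0 / 2)"])
        (simp only: J_matrix J_connection scaleR_zero_left scaleR_minus_left add_0 add_uminus_conv_diff)
  next
    assume "B = matrix (J2 e1 e2)"
    then show ?thesis
      by (intro combine[of B "e1 * e2 * sqrt 3 * x $ BU1 / 2 - e2 * x $ BV0 / 2" 0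
            "e2 * x $ BV2 / 2 - sqrt 3 * x $ BA / 2"])
        (simp only: J_matrix J_connection scaleR_zero_left add_0_right)
  next
    assume "B = matrix (J3 e1 e2)"
    then show ?thesis
      by (intro combine[of B "- e2 * x $ BU0 / 2 - e1 * e2 * sqrt 3 * x $ BV1 / 2"
            "e1 * e2 * x $ BV2 / 2 - e1 * sqrt 3 * x $ BA / 2" 0])
        (simp only: J_matrix J_connection scaleR_zero_left add_0_right)
  qed
  have "?G ** A - A ** ?G \<in> span ?S"
  proof (rule span_induct[of A ?S "\<lambda>A. ?G ** A - A ** ?G \<in> span ?S"])
    show "A \<in> span ?S"
      using assms by (simp add: quat_matrices_def)
    show "subspace {A. ?G ** A - A ** ?G \<in> span ?S}"
    proof (rule subspaceI)
      show "0 \<in> {A. ?G ** A - A ** ?G \<in> span ?S}"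
        by (simp add: span_zero)
      fix B C and r :: real
      assume B: "B \<in> {A. ?G ** A - A ** ?G \<in> span ?S}" and C: "C \<in> {A. ?G ** A - A ** ?G \<in> span ?S}"
      have "?G ** (B + C) - (B + C) ** ?G = (?G ** B - B ** ?G) + (?G ** C - C ** ?G)"
        by (simp add: vec_eq_iff matrix_matrix_mult_def sum.distrib algebra_simps)
      then show "B + C \<in> {A. ?G ** A - A ** ?G \<in> span ?S}"
        using B C by (simp only: mem_Collect_eq span_add)
      have "?G ** (r *\<^sub>R B) - (r *\<^sub>R B) ** ?G = r *\<^sub>R (?G ** B - B ** ?G)"
        by (simp add: matrix_scalar_ac scaleR_diff_right flip: scalar_matrix_assoc)
      then show "r *\<^sub>R B \<in> {A. ?G ** A - A ** ?G \<in> span ?S}"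
        using B by (simp only: mem_Collect_eq span_scale)
    qed
  qed (use gen in auto)
  then show ?thesis
    by (simp add: quat_matrices_def)
qed

lemma invariant_endo_mult:
  "I1 p o\<^sub>L I2 p = I3 p" "I2 p o\<^sub>L I1 p = - I3 p"
  "I2 p o\<^sub>L I3 p = - e2 *\<^sub>R I1 p" "I3 p o\<^sub>L I2 p = e2 *\<^sub>R I1 p"
  "I3 p o\<^sub>L I1 p = - e1 *\<^sub>R I2 p" "I1 p o\<^sub>L I3 p = e1 *\<^sub>R I2 p"
  "I1 p o\<^sub>L I1 p = e1 *\<^sub>R id_blinfun" "I2 p o\<^sub>L I2 p = e2 *\<^sub>R id_blinfun"
  "I3 p o\<^sub>L I3 p = (- e1 * e2) *\<^sub>R id_blinfun"
  by (rule blinfun_eqI;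
      simp add: invariant_endo_apply linear_J J_mult J_square frame_neg frame_scaleR
        uminus_blinfun.rep_eq scaleR_blinfun.rep_eq)+

text \<open>For (-1, -1) all three squares are negative and \<epsilon> is -1. For (-1, 1) the
  negative square is that of \<open>I1\<close>, for (1, -1) that of \<open>I2\<close>; the other two
  are then positive and \<epsilon> is 1.\<close>

lemma eps_quaternionic_algebra_fibre:
  assumes "(e1, e2) \<in> {(-1, -1), (-1, 1), (1, -1)}"
  shows "eps_quaternionic_algebra (- e1 * e2) (metric p) (span {I1 p, I2 p, I3 p})"
  unfolding eps_quaternionic_algebra_def
proof (intro exI conjI)
  show "skew_endo (metric p) (I1 p)" "skew_endo (metric p) (I2 p)" "skew_endo (metric p) (I3 p)"
    by (intro skew_invariant_endo linear_J J_skew)+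
qed (use assms in \<open>auto simp: invariant_endo_mult\<close>)

lemma eps_quaternionic_kaehler_group:
  assumes "(e1, e2) \<in> {(-1, -1), (-1, 1), (1, -1)}"
  shows "eps_quaternionic_kaehler M (- e1 * e2) metric (\<lambda>p. span {I1 p, I2 p, I3 p})"
  unfolding eps_quaternionic_kaehler_def
proof (intro conjI allI impI)
  have "CARD(iwa_index) = 8"
    by (simp add: UNIV_iwa_index)
  then show "\<exists>n>1. DIM('b) = 4 * n"
    using dim_model by (intro exI[of _ 2]) simp
  show "endo_subbundle M 3 (\<lambda>p. span {I1 p, I2 p, I3 p})"
    using J_independent by (intro endo_subbundle_invariant linear_J) blast
  show "\<exists>D. levi_civita M metric D"
    using levi_civita_connection by blast
  show "parallel_subbundle M D (\<lambda>p. span {I1 p, I2 p, I3 p})" if "levi_civita M metric D" for D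
    using that quat_bundle_eq quat_matrices_stable
    by (intro parallel_invariant_subbundle[where q = quat_matrices])
      (auto simp: quat_matrices_def subspace_span)
qed (rule smooth_manifold pseudo_riemannian_metric eps_quaternionic_algebra_fibre[OF assms])+

lemma differential_frame: "differential M (mul a) p (\<iota> x p) = \<iota> x (mul a p)"
proof -
  have "range \<iota> = {X. smooth_vf M X \<and> left_invariant_vf M mul X}"
    using iso by (simp add: lie_algebra_iso_def bij_betw_def)
  then have "left_invariant_vf M mul (\<iota> x)"
    by blast
  then show ?thesis
    by (simp add: left_invariant_vf_def)
qed

text \<open>In frame components every left translation is the identity, which makes constant frame
  matrices left-invariant.\<close>

lemma differential_eq: "differential M (mul a) p v = \<iota> (left_triv \<iota> p v) (mul a p)"
  using differential_frame[of a p "left_triv \<iota> p v"] by simp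

lemma left_invariant_invariant_endo: "linear A \<Longrightarrow> left_invariant_endo M mul (invariant_endo \<iota> A)"
  by (simp add: left_invariant_endo_def differential_eq invariant_endo_apply)

lemma left_invariant_quat_bundle: "left_invariant_subbundle M mul (\<lambda>p. span {I1 p, I2 p, I3 p})"
  unfolding left_invariant_subbundle_def quat_bundle_eq
proof (intro allI set_eqI iffI)
  fix a p R
  let ?E = "\<lambda>A. invariant_endo \<iota> ((*v) A)"
  have inv: "blinfun_apply (?E A (mul a p)) (differential M (mul a) p v) =
      differential M (mul a) p (blinfun_apply (?E A p) v)" for A v
    using left_invariant_invariant_endo[of "(*v) A"] by (simp add: left_invariant_endo_def)
  show "R \<in> {R. \<exists>S\<in>(\<lambda>A. ?E A p) ` quat_matrices. \<forall>v.
      blinfun_apply R (differential M (mul a) p v) = differential M (mul a) p (blinfun_apply S v)}"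
    if "R \<in> (\<lambda>A. ?E A (mul a p)) ` quat_matrices"
    using that inv by blast
  assume "R \<in> {R. \<exists>S\<in>(\<lambda>A. ?E A p) ` quat_matrices. \<forall>v.
      blinfun_apply R (differential M (mul a) p v) = differential M (mul a) p (blinfun_apply S v)}"
  then obtain A where A: "A \<in> quat_matrices" and R: "\<And>v. blinfun_apply R (differential M (mul a) p v) =
      differential M (mul a) p (blinfun_apply (?E A p) v)"
    by blast
  \<comment> \<open>The differential of a translation is onto the tangent space at
    \<open>mul a p\<close>, so the values on its image determine \<open>R\<close>.\<close>
  have "R = ?E A (mul a p)"
  proof (rule blinfun_eqI)
    fix w
    have "w = differential M (mul a) p (\<iota> (left_triv \<iota> (mul a p) w) p)"
      by (simp add: differential_frame)
    then show "blinfun_apply R w = blinfun_apply (?E A (mul a p)) w"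
      using R inv by metis
  qed
  then show "R \<in> (\<lambda>A. ?E A (mul a p)) ` quat_matrices"
    using A by blast
qed

lemma eps_complex_structure:
  assumes A: "A = J1 e1 e2 \<or> A = J1_tilde e1 e2"
  shows "left_invariant_endo M mul (invariant_endo \<iota> A)" (is ?inv)
    and "skew_endo (metric p) (invariant_endo \<iota> A p)" (is ?skew)
    and "almost_eps_complex M e1 (invariant_endo \<iota> A)" (is ?cplx)
    and "integrable_endo M (invariant_endo \<iota> A)" (is ?int)
proof -
  have lin: "linear A"
    using A linear_J by auto
  show ?inv
    by (rule left_invariant_invariant_endo[OF lin])
  show ?skew
    by (rule skew_invariant_endo[OF lin]) (use A J_skew in auto)
  show ?int
    by (rule integrable_invariant_endo[OF lin J_integrable[OF A]])
  have "A (A x) = e1 *\<^sub>R x" for x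
    using A J_square by auto
  then have "invariant_endo \<iota> A p o\<^sub>L invariant_endo \<iota> A p = e1 *\<^sub>R id_blinfun" for p
    by (intro blinfun_eqI) (simp add: invariant_endo_apply lin frame_scaleR scaleR_blinfun.rep_eq)
  moreover have "dim {v. blinfun_apply (invariant_endo \<iota> A p) v = v} =
      dim {v. blinfun_apply (invariant_endo \<iota> A p) v = - v}" for p
    by (rule dim_eigenspaces_eq[OF lin linear_grading])
      (use A J_grading grading_grading in \<open>auto intro: inj_on_inverseI\<close>)
  ultimately show ?cplx
    by (simp add: almost_eps_complex_def smooth_invariant_endo[OF lin])
qed

end

theorem theorem2:
  fixes M :: "('a::{t2_space,second_countable_topology}, 'b::euclidean_space) atlas"
    and mul :: "'a \<Rightarrow> 'a \<Rightarrow> 'a" and e :: 'a and inver :: "'a \<Rightarrow> 'a"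
    and \<iota> :: "iwa \<Rightarrow> 'a \<Rightarrow> 'b"
    and \<epsilon> \<epsilon>\<^sub>1 \<epsilon>\<^sub>2 :: real
    and g :: "'a \<Rightarrow> 'b \<Rightarrow> 'b \<Rightarrow> real"
    and Q :: "'a \<Rightarrow> ('b \<Rightarrow>\<^sub>L 'b) set"
  assumes signs: "(\<epsilon>\<^sub>1, \<epsilon>\<^sub>2) \<in> {(-1, -1), (-1, 1), (1, -1)}" "\<epsilon> = - \<epsilon>\<^sub>1 * \<epsilon>\<^sub>2"
    and L: "lie_group M mul e inver" "simply_connected (UNIV :: 'a set)"
    and iso: "lie_algebra_iso M mul iwa_bracket \<iota>"
    and g: "g = invariant_form \<iota> (iwa_form \<epsilon>\<^sub>1 \<epsilon>\<^sub>2)"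
    and Q: "Q = (\<lambda>p. span {invariant_endo \<iota> (J1 \<epsilon>\<^sub>1 \<epsilon>\<^sub>2) p,
                           invariant_endo \<iota> (J2 \<epsilon>\<^sub>1 \<epsilon>\<^sub>2) p,
                           invariant_endo \<iota> (J3 \<epsilon>\<^sub>1 \<epsilon>\<^sub>2) p})"
  shows "eps_quaternionic_kaehler M \<epsilon> g Q \<and>
    left_invariant_subbundle M mul Q \<and>
    (\<forall>J \<in> {invariant_endo \<iota> (J1 \<epsilon>\<^sub>1 \<epsilon>\<^sub>2), invariant_endo \<iota> (J1_tilde \<epsilon>\<^sub>1 \<epsilon>\<^sub>2)}.
       left_invariant_endo M mul J \<and> (\<forall>p. skew_endo (g p) (J p)) \<and>
       almost_eps_complex M \<epsilon>\<^sub>1 J \<and> integrable_endo M J)"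
proof -
  have "smooth_manifold M"
    using L by (simp add: lie_group_def)
  moreover have "\<epsilon>\<^sub>1 \<in> {-1, 1}" "\<epsilon>\<^sub>2 \<in> {-1, 1}"
    using signs(1) by auto
  ultimately interpret iwa_group M mul e inver \<epsilon>\<^sub>1 \<epsilon>\<^sub>2 \<iota>
    using L iso by (intro iwa_group.intro smooth_group.intro manifold.intro smooth_group_axioms.intro
        iwa_signs.intro iwa_group_axioms.intro)
  show ?thesis
    unfolding g Q signs(2)
    using eps_quaternionic_kaehler_group[OF signs(1)] left_invariant_quat_bundle eps_complex_structure
    by blast
qed

end
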